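(* Let $\pi,\pi'\in\Pi$ be shipment policies with associated express shipment demand profiles $\mathbf{C}^{\pi}$ and $\mathbf{C}^{\pi'}$. Then: (1) There exist unique shipment policies $\pi^{min}$ and $\pi^{max}$ such that $\mathbf{C}^{\pi^{min}}=\min(\mathbf{C}^{\pi},\mathbf{C}^{\pi'})$ and $\mathbf{C}^{\pi^{max}}=\max(\mathbf{C}^{\pi},\mathbf{C}^{\pi'})$, where $\min$ and $\max$ are taken componentwise. (2) The expected backorders are submodular in $\mathbf{C}$, i.e. $\mathbb{E}[B^{\pi^{min}}]+\mathbb{E}[B^{\pi^{max}}]\le \mathbb{E}[B^{\pi}]+\mathbb{E}[B^{\pi'}]$. (3) The expected profit is supermodular in $\mathbf{C}$, i.e. $\mathbb{E}[G^{\pi^{min}}]+\mathbb{E}[G^{\pi^{max}}]\ge \mathbb{E}[G^{\pi}]+\mathbb{E}[G^{\pi'}]$.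
   Context: Model. Fix $T\in\mathbb{N}$, $T\ge 1$, $\lambda>0$, $\beta>0$, reals $0\le U_{\min}<U_{\max}<\infty$, and a discrete random variable $K$ with support $\mathbb{N}_0$ such that $\rho=\lambda/\mathbb{E}[K]<1$. Put $w(f)=\frac{U_{\max}-f}{U_{\max}-U_{\min}}$ for $f\in[U_{\min},U_{\max}]$. Policies. A shipment policy is $\pi=(\bar\tau,f_0,\dots,f_{\bar\tau})$ with cutoff point $\bar\tau\in\{0,\dots,T-1\}$ and fees $f_\tau\in[U_{\min},U_{\max}]$ for $\tau=0,\dots,\bar\tau$; $\Pi$ is the set of all of them. Dynamics under $\pi$. Time is $t\in\mathbb{N}_0$; the age is $\tau=t \bmod T$; cycle $l$ is $\{lT,\dots,lT+T-1\}$. For each $t$ with age $\tau$: if $\tau\le\bar\tau$, $E_t\sim\mathrm{Poi}(w(f_\tau)\lambda)$ (express orders) and $N_t\sim\mathrm{Poi}((1-w(f_\tau))\lambda)$ (regular orders); if $\tau>\bar\tau$, $E_t=0$ and $N_t\sim\mathrm{Poi}(\lambda)$. Let $D_t=E_t+N_t$, and $K_t\sim K$ (processing capacity). All $E_t,N_t,K_t$, $t\in\mathbb{N}_0$, are independent. The total backlog $X^\Sigma$ and the high-urgency backlog $X^h$ evolve by $X^\Sigma_{t+1}=(X^\Sigma_t+D_t-K_t)^+$, and $X^h_{t+1}=(X^h_t+E_t-K_t)^+$ if $t\bmod T\ne T-1$, $X^h_{t+1}=(X^\Sigma_t+D_t-K_t)^+$ if $t\bmod T=T-1$, where $x^+=\max(x,0)$,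 from a fixed deterministic initial state with $X^h_0\le X^\Sigma_0$. Performance. The backorders of cycle $l$ are $B_l=(X^h_{lT+T-1}+E_{lT+T-1}-K_{lT+T-1})^+$, and $\mathbb{E}[B^\pi]=\lim_{L\to\infty}\frac1L\sum_{l=0}^{L-1}\mathbb{E}[B_l]$ is their long-run average under $\pi$. The expected revenue is $\mathbb{E}[R^\pi]=\lambda\sum_{\tau=0}^{\bar\tau}f_\tau w(f_\tau)$ and the expected profit is $\mathbb{E}[G^\pi]=\mathbb{E}[R^\pi]-\beta\,\mathbb{E}[B^\pi]$. Demand profile. $\mathbf{C}^\pi=(C^\pi_{-1},C^\pi_0,\dots,C^\pi_{T-1})$ with $C^\pi_{-1}=0$ and $C^\pi_\tau=\lambda\sum_{j=0}^{\min(\tau,\bar\tau)}w(f_j)$ (expected cumulative express orders up to age $\tau$).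
   Formalization: Uniqueness in (1) is up to fees U_max charged at the last ages before the cutoff: for T ≥ 2 the policies (0,f_0) and (1,f_0,U_max) have the same profile since w(U_max)=0, so literal uniqueness fails; policies are identified when their fees, padded with U_max after the cutoff, agree. *)

theory Defs
  imports "HOL-Probability.Probability"
begin

record shipment_model =
  horizon :: nat              (* T *)
  rate :: real                (* lambda *)
  penalty :: real             (* beta *)
  fee_min :: real             (* U_min *)
  fee_max :: real             (* U_max *)
  capacity :: "nat pmf"       (* law of K *)
  init_total :: nat           (* total backlog at time 0 *)
  init_high :: nat            (* high-urgency backlog at time 0 *)

definition weight :: "shipment_model \<Rightarrow> real \<Rightarrow> real" where
  "weight m f = (fee_max m - f) / (fee_max m - fee_min m)"

(* The tuple (c, f_0, ..., f_c) is the pair of the cutoff c and the list [f_0, ..., f_c]. *)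
type_synonym policy = "nat \<times> real list"

definition policies :: "shipment_model \<Rightarrow> policy set" where
  "policies m = {(c, fs). c < horizon m \<and> length fs = c + 1 \<and> set fs \<subseteq> {fee_min m..fee_max m}}"

(* At fee U_max the express demand weight is 0, so charging U_max at the last ages up to the
   cutoff is the same as closing the express service earlier.  Policies are identified exactly
   up to this: padded with U_max after the cutoff, the two fee sequences agree. *)
definition padded_fee :: "shipment_model \<Rightarrow> policy \<Rightarrow> nat \<Rightarrow> real" where
  "padded_fee m p \<tau> = (if \<tau> \<le> fst p then snd p ! \<tau> else fee_max m)"

definition policy_equiv :: "shipment_model \<Rightarrow> policy \<Rightarrow> policy \<Rightarrow> bool" where
  "policy_equiv m p q \<longleftrightarrow> (\<forall>\<tau><horizon m. padded_fee m p \<tau> = padded_fee m q \<tau>)"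

(* The library's poisson_pmf is specified for positive rates only. *)
definition Poi :: "real \<Rightarrow> nat pmf" where
  "Poi r = (if r = 0 then return_pmf 0 else poisson_pmf r)"

definition express_law :: "shipment_model \<Rightarrow> policy \<Rightarrow> nat \<Rightarrow> nat pmf" where
  "express_law m p t = (let \<tau> = t mod horizon m in
     if \<tau> \<le> fst p then Poi (weight m (snd p ! \<tau>) * rate m) else return_pmf 0)"

definition regular_law :: "shipment_model \<Rightarrow> policy \<Rightarrow> nat \<Rightarrow> nat pmf" where
  "regular_law m p t = (let \<tau> = t mod horizon m in
     if \<tau> \<le> fst p then Poi ((1 - weight m (snd p ! \<tau>)) * rate m) else Poi (rate m))"

(* Sample paths: at each time t the triple (E_t, N_t, K_t). *)
type_synonym path = "nat \<Rightarrow> nat \<times> nat \<times> nat"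

abbreviation express :: "path \<Rightarrow> nat \<Rightarrow> nat" where "express \<omega> t \<equiv> fst (\<omega> t)"
abbreviation regular :: "path \<Rightarrow> nat \<Rightarrow> nat" where "regular \<omega> t \<equiv> fst (snd (\<omega> t))"
abbreviation processed :: "path \<Rightarrow> nat \<Rightarrow> nat" where "processed \<omega> t \<equiv> snd (snd (\<omega> t))"

(* All E_t, N_t, K_t independent with the prescribed laws. *)
definition path_measure :: "shipment_model \<Rightarrow> policy \<Rightarrow> path measure" where
  "path_measure m p = (\<Pi>\<^sub>M t\<in>UNIV.
     measure_pmf (pair_pmf (express_law m p t) (pair_pmf (regular_law m p t) (capacity m))))"

(* Subtraction on nat is truncated, so a - b is the positive part of a - b. *)
primrec total_backlog :: "shipment_model \<Rightarrow> path \<Rightarrow> nat \<Rightarrow> nat" where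
  "total_backlog m \<omega> 0 = init_total m"
| "total_backlog m \<omega> (Suc t) =
     total_backlog m \<omega> t + (express \<omega> t + regular \<omega> t) - processed \<omega> t"

primrec high_backlog :: "shipment_model \<Rightarrow> path \<Rightarrow> nat \<Rightarrow> nat" where
  "high_backlog m \<omega> 0 = init_high m"
| "high_backlog m \<omega> (Suc t) =
     (if t mod horizon m \<noteq> horizon m - 1
      then high_backlog m \<omega> t + express \<omega> t - processed \<omega> t
      else total_backlog m \<omega> t + (express \<omega> t + regular \<omega> t) - processed \<omega> t)"

definition backorders :: "shipment_model \<Rightarrow> path \<Rightarrow> nat \<Rightarrow> nat" where
  "backorders m \<omega> l = (let t = l * horizon m + horizon m - 1 in
     high_backlog m \<omega> t + express \<omega> t - processed \<omega> t)"

definition expected_backorders :: "shipment_model \<Rightarrow> policy \<Rightarrow> real" where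
  "expected_backorders m p =
     lim (\<lambda>L. (\<Sum>l<L. \<integral>\<omega>. real (backorders m \<omega> l) \<partial>path_measure m p) / real L)"

definition expected_revenue :: "shipment_model \<Rightarrow> policy \<Rightarrow> real" where
  "expected_revenue m p = rate m * (\<Sum>\<tau>\<le>fst p. snd p ! \<tau> * weight m (snd p ! \<tau>))"

definition expected_profit :: "shipment_model \<Rightarrow> policy \<Rightarrow> real" where
  "expected_profit m p = expected_revenue m p - penalty m * expected_backorders m p"

(* The list [C_{-1}, C_0, ..., C_{T-1}]; entry \<tau> + 1 is C_\<tau>. *)
definition profile :: "shipment_model \<Rightarrow> policy \<Rightarrow> real list" where
  "profile m p =
     0 # map (\<lambda>\<tau>. rate m * (\<Sum>j\<le>min \<tau> (fst p). weight m (snd p ! j))) [0..<horizon m]"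

end

theory Submission
  imports Defs
begin

text \<open>
  A policy acts on the backorders only through the law of its express orders, and these are the
  increments of a unit-rate Poisson process \<open>N\<close> read off at the levels of the demand profile: the
  cumulative express orders of a cycle are \<open>N(C\<^sub>0), \<dots>, N(C\<^bsub>T-1\<^esub>)\<close>. Using the same \<open>N\<close> and the same
  capacities for four policies with profiles \<open>C\<close>, \<open>C'\<close>, \<open>min C C'\<close>, \<open>max C C'\<close> turns minima and maxima
  of profiles into minima and maxima of realized cumulative orders, because \<open>N\<close> is monotone. Only
  the finitely many levels that occur matter, so a finite family of independent Poisson variables
  replaces the process (\<open>level_arrivals_law\<close>).

  Pathwise, let \<open>h\<close> be the high-urgency backlog in a cycle, \<open>A\<close> the cumulative express orders and
  \<open>y = h - A\<close>. Then \<open>y(n+1) = max (y(n) - k(n)) (- A(n+1))\<close>, so \<open>y\<close> is the maximum of terms each of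
  which depends on \<open>A\<close> at one age only and is nonincreasing in it. Hence \<open>y\<close> at the minimum of two
  order streams is the maximum of their \<open>y\<close>, at the maximum it is at most the minimum, and \<open>y\<close> is
  submodular; \<open>A\<close> itself is modular. This gives \<open>queue_submodular\<close>, and with the coupling
  \<open>mean_queue_submodular\<close>.

  The high-urgency backlog at the start of a cycle is the initial one or, from the second cycle on,
  the total backlog, which is driven by the total demand, of rate \<open>\<lambda>\<close> whatever the policy. So in
  every cycle the four policies are compared from the
  same initial law, and submodularity holds cycle by cycle. It passes to the long-run average once
  that average is known to converge. For this, two copies of the total backlog started one unit
  apart stay apart only while the queue does not empty; the weight \<open>\<theta>\<^sup>x\<close> with
  \<open>\<phi> = E(\<theta>^(D - K)) < 1\<close>, available for some \<open>\<theta> > 1\<close> because the drift is negative, makes this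
  a geometric contraction (\<open>mean_step_contraction\<close>, \<open>mean_queue_converges\<close>).

  The revenue at one age is a concave quadratic function of the profile increment, and a concave
  function of a difference of two coordinates is supermodular. Together with the penalty term this
  yields the claim on profits. The policies realizing minimum and maximum exist because the
  increments of both stay in \<open>[0, \<lambda>]\<close>, and the increments determine the fees.
\<close>

section \<open>Poisson laws\<close>

lemma pmf_map_add_left:
  fixes q :: "nat pmf"
  shows "pmf (map_pmf ((+) i) q) n = (if i \<le> n then pmf q (n - i) else 0)"
proof (cases "i \<le> n")
  case True
  then have "pmf (map_pmf ((+) i) q) (i + (n - i)) = pmf q (n - i)"
    by (intro pmf_map_inj') auto
  with True show ?thesis by simp
next
  case False
  then show ?thesis by (auto intro!: pmf_map_outside)
qed

lemma Poi_add:
  assumes "a \<ge> 0" "b \<ge> 0"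
  shows "map_pmf (\<lambda>(i, j). i + j) (pair_pmf (Poi a) (Poi b)) = Poi (a + b)"
proof (cases "a = 0 \<or> b = 0")
  case True
  then show ?thesis
    by (auto simp: Poi_def pair_return_pmf1 pair_return_pmf2 pmf.map_comp o_def)
next
  case False
  with assms have ab: "a > 0" "b > 0" by auto
  have exp_split: "exp (- a - b) = exp (- a) * exp (- b)" by (simp add: exp_add [symmetric])
  have "map_pmf (\<lambda>(i, j). i + j) (pair_pmf (Poi a) (Poi b)) =
      bind_pmf (poisson_pmf a) (\<lambda>i. map_pmf ((+) i) (poisson_pmf b))"
    using ab by (simp add: Poi_def pair_pmf_def map_pmf_def bind_assoc_pmf bind_return_pmf)
  also have "\<dots> = poisson_pmf (a + b)"
  proof (rule pmf_eqI)
    fix n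
    have "pmf (bind_pmf (poisson_pmf a) (\<lambda>i. map_pmf ((+) i) (poisson_pmf b))) n =
        (\<integral>i. pmf (map_pmf ((+) i) (poisson_pmf b)) n \<partial>poisson_pmf a)"
      by (simp add: pmf_bind)
    also have "\<dots> = (\<Sum>i\<le>n. pmf (map_pmf ((+) i) (poisson_pmf b)) n * pmf (poisson_pmf a) i)"
      by (rule integral_measure_pmf_real) (auto simp: pmf_map_add_left split: if_splits)
    also have "\<dots> = (\<Sum>i\<le>n. (of_nat (n choose i) * a ^ i * b ^ (n - i)) * (exp (- (a + b)) / fact n))"
      by (intro sum.cong refl)
        (use ab in \<open>simp add: pmf_map_add_left binomial_fact exp_split field_simps\<close>)
    also have "\<dots> = (a + b) ^ n * (exp (- (a + b)) / fact n)"
      by (simp only: sum_distrib_right [symmetric] binomial_ring)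
    also have "\<dots> = pmf (poisson_pmf (a + b)) n"
      using ab by (simp add: field_simps)
    finally show "pmf (bind_pmf (poisson_pmf a) (\<lambda>i. map_pmf ((+) i) (poisson_pmf b))) n =
        pmf (poisson_pmf (a + b)) n" .
  qed
  finally show ?thesis using ab by (simp add: Poi_def)
qed

lemma nn_integral_power_Poi:
  assumes "r \<ge> 0" "\<theta> \<ge> 0"
  shows "(\<integral>\<^sup>+n. ennreal (\<theta> ^ n) \<partial>Poi r) = ennreal (exp (r * (\<theta> - 1)))"
proof (cases "r = 0")
  case True
  then show ?thesis by (simp add: Poi_def)
next
  case False
  with assms have r: "r > 0" by simp
  have sums: "(\<lambda>n. r ^ n / fact n * exp (- r) * \<theta> ^ n) sums (exp (r * (\<theta> - 1)))"
  proof -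
    have "(\<lambda>n. (r * \<theta>) ^ n /\<^sub>R fact n * exp (- r)) sums (exp (r * \<theta>) * exp (- r))"
      by (intro sums_mult2 exp_converges)
    then show ?thesis
      by (simp add: exp_add [symmetric] algebra_simps power_mult_distrib divide_inverse)
  qed
  have "(\<integral>\<^sup>+n. ennreal (\<theta> ^ n) \<partial>Poi r) =
      (\<Sum>n. ennreal (pmf (poisson_pmf r) n) * ennreal (\<theta> ^ n))"
    using r by (simp add: Poi_def nn_integral_measure_pmf nn_integral_count_space_nat)
  also have "\<dots> = (\<Sum>n. ennreal (r ^ n / fact n * exp (- r) * \<theta> ^ n))"
    using r assms by (intro suminf_cong) (simp add: ennreal_mult [symmetric])
  also have "\<dots> = ennreal (exp (r * (\<theta> - 1)))"
    using sums r assms by (subst suminf_ennreal_eq) auto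
  finally show ?thesis .
qed

lemma integrable_power_Poi:
  fixes \<theta> :: real
  assumes "r \<ge> 0" "\<theta> \<ge> 0"
  shows "integrable (Poi r) (\<lambda>n. \<theta> ^ n)"
  by (rule integrableI_nonneg) (use assms in \<open>simp_all add: nn_integral_power_Poi\<close>)

lemma integrable_Poi:
  assumes "r \<ge> 0"
  shows "integrable (Poi r) real"
proof (rule Bochner_Integration.integrable_bound)
  show "integrable (Poi r) (\<lambda>n. 2 ^ n :: real)"
    using integrable_power_Poi [OF assms, of 2] by simp
  show "AE n in Poi r. norm (real n) \<le> norm (2 ^ n :: real)"
    by (simp add: of_nat_less_two_power less_imp_le)
qed simp


section \<open>The queue with truncation at zero\<close>

primrec queue :: "nat \<Rightarrow> (nat \<Rightarrow> nat) \<Rightarrow> (nat \<Rightarrow> nat) \<Rightarrow> nat \<Rightarrow> nat" where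
  "queue x e k 0 = x"
| "queue x e k (Suc n) = queue x e k n + e n - k n"

lemma queue_cong:
  assumes "\<And>i. i < n \<Longrightarrow> e i = e' i" "\<And>i. i < n \<Longrightarrow> k i = k' i"
  shows "queue x e k n = queue x e' k' n"
  using assms by (induction n) auto

lemma queue_le: "queue x e k n \<le> x + (\<Sum>i<n. e i)"
  by (induction n) auto

lemma queue_Suc_start:
  "queue x e k n \<le> queue (Suc x) e k n \<and> queue (Suc x) e k n \<le> Suc (queue x e k n)"
  by (induction n) auto

text \<open>The quantity \<open>y = queue - A\<close>, with \<open>A\<close> the cumulative arrivals, has the recursion
  \<open>y (Suc i) = max (y i - k i) (- A (Suc i))\<close>, in which arrivals enter only through \<open>A\<close>. A pointwise
  minimum of two \<open>A\<close> therefore gives exactly the maximum of the two \<open>y\<close>, and a pointwise maximum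
  gives at most their minimum.\<close>
lemma queue_submodular:
  fixes e e' emin emax :: "nat \<Rightarrow> nat"
  defines "A \<equiv> \<lambda>(e :: nat \<Rightarrow> nat) n. (\<Sum>i<n. e i)"
  assumes min: "\<And>i. i \<le> n \<Longrightarrow> A emin i = min (A e i) (A e' i)"
    and max: "\<And>i. i \<le> n \<Longrightarrow> A emax i = max (A e i) (A e' i)"
  shows "queue x emin k n + queue x emax k n \<le> queue x e k n + queue x e' k n"
proof -
  define y where "y e n = int (queue x e k n) - int (A e n)" for e n
  have y_Suc: "y e (Suc i) = max (y e i - int (k i)) (- int (A e (Suc i)))" for e i
    by (auto simp: y_def A_def)
  have y_0: "y e 0 = int x" for e by (simp add: y_def A_def)
  have "y emin i = max (y e i) (y e' i) \<and> y emax i \<le> y e i \<and> y emax i \<le> y e' i"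
    if "i \<le> n" for i
    using that
  proof (induction i)
    case 0
    then show ?case by (simp add: y_0)
  next
    case (Suc i)
    then have IH: "y emin i = max (y e i) (y e' i)" "y emax i \<le> y e i" "y emax i \<le> y e' i"
      by auto
    have "y emin (Suc i) = max (y e (Suc i)) (y e' (Suc i))"
      unfolding y_Suc min [OF Suc.prems] IH(1) by (simp add: max_def min_def)
    moreover have "y emax (Suc i) \<le> y e (Suc i)" "y emax (Suc i) \<le> y e' (Suc i)"
      unfolding y_Suc max [OF Suc.prems] using IH(2,3) by (auto intro!: max.mono)
    ultimately show ?case by simp
  qed
  from this [of n]
  have "y emin n + y emax n \<le> y e n + y e' n" by (auto simp: max_def)
  moreover have "A emin n + A emax n = A e n + A e' n"
    using min [of n] max [of n] by (simp add: max_def min_def)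
  ultimately show ?thesis unfolding y_def by linarith
qed

primrec queue_law :: "(nat \<Rightarrow> nat pmf) \<Rightarrow> nat pmf \<Rightarrow> nat \<Rightarrow> nat \<Rightarrow> nat pmf" where
  "queue_law a \<kappa> x 0 = return_pmf x"
| "queue_law a \<kappa> x (Suc n) =
     bind_pmf (queue_law a \<kappa> x n) (\<lambda>h. map_pmf (\<lambda>(e, k). h + e - k) (pair_pmf (a n) \<kappa>))"

text \<open>The two orders of sampling that \<open>queue_law_eq_map\<close> has to reconcile: step by step in time, and
  all arrivals before all capacities.\<close>
lemma bind_pmf_rotate:
  "bind_pmf P (\<lambda>p. bind_pmf Q (\<lambda>q. bind_pmf R (\<lambda>r. bind_pmf S (\<lambda>s. f p q r s)))) =
   bind_pmf R (\<lambda>r. bind_pmf P (\<lambda>p. bind_pmf S (\<lambda>s. bind_pmf Q (\<lambda>q. f p q r s))))"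
  by (simp only: bind_commute_pmf [of Q R] bind_commute_pmf [of Q S] bind_commute_pmf [of P R])

lemma queue_law_eq_map:
  "queue_law a \<kappa> x n = map_pmf (\<lambda>(e, k). queue x e k n)
     (pair_pmf (Pi_pmf {..<n} 0 a) (Pi_pmf {..<n} 0 (\<lambda>_. \<kappa>)))"
proof (induction n)
  case 0
  then show ?case by simp
next
  case (Suc n)
  let ?E = "Pi_pmf {..<n} 0 a" and ?K = "Pi_pmf {..<n} 0 (\<lambda>_. \<kappa>)"
  have upd: "queue x (e(n := d)) (k(n := c)) n = queue x e k n" for e k c d
    by (rule queue_cong) auto
  have "queue_law a \<kappa> x (Suc n) = bind_pmf ?E (\<lambda>e. bind_pmf ?K (\<lambda>k.
      bind_pmf (a n) (\<lambda>d. bind_pmf \<kappa> (\<lambda>c. return_pmf (queue x e k n + d - c)))))"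
    by (simp add: Suc.IH pair_pmf_def map_pmf_def bind_assoc_pmf bind_return_pmf)
  also have "\<dots> = bind_pmf (a n) (\<lambda>d. bind_pmf ?E (\<lambda>e.
      bind_pmf \<kappa> (\<lambda>c. bind_pmf ?K (\<lambda>k. return_pmf (queue x e k n + d - c)))))"
    by (rule bind_pmf_rotate)
  also have "\<dots> = map_pmf (\<lambda>(e, k). queue x e k (Suc n))
      (pair_pmf (Pi_pmf {..<Suc n} 0 a) (Pi_pmf {..<Suc n} 0 (\<lambda>_. \<kappa>)))"
    by (simp add: lessThan_Suc Pi_pmf_insert pair_pmf_def map_pmf_def bind_assoc_pmf
        bind_return_pmf upd)
  finally show ?case .
qed

text \<open>Splitting off the first step instead of the last makes the mean of a function of the queue an
  iterate of one operator on functions of the initial state.\<close>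
lemma queue_law_Suc_first:
  "queue_law (\<lambda>_. a) \<kappa> x (Suc n) =
     bind_pmf (map_pmf (\<lambda>(d, k). x + d - k) (pair_pmf a \<kappa>)) (\<lambda>y. queue_law (\<lambda>_. a) \<kappa> y n)"
proof (induction n)
  case 0
  show ?case by (simp add: bind_return_pmf) (simp add: bind_return_pmf' del: bind_map_pmf)
next
  case (Suc n)
  have "queue_law (\<lambda>_. a) \<kappa> x (Suc (Suc n)) = bind_pmf (queue_law (\<lambda>_. a) \<kappa> x (Suc n))
      (\<lambda>h. map_pmf (\<lambda>(e, k). h + e - k) (pair_pmf a \<kappa>))"
    by (rule queue_law.simps)
  also have "\<dots> = bind_pmf (map_pmf (\<lambda>(d, k). x + d - k) (pair_pmf a \<kappa>))
      (\<lambda>y. queue_law (\<lambda>_. a) \<kappa> y (Suc n))"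
    unfolding Suc.IH bind_assoc_pmf by simp
  finally show ?case .
qed

section \<open>Coupling Poisson arrivals with different rates\<close>

lemma map_sum_Pi_pmf_Poi:
  assumes "finite B" "\<And>v. v \<in> B \<Longrightarrow> r v \<ge> 0"
  shows "map_pmf (\<lambda>Z. \<Sum>v\<in>B. Z v) (Pi_pmf B 0 (\<lambda>v. Poi (r v))) = Poi (\<Sum>v\<in>B. r v)"
  using assms
proof (induction B rule: finite_induct)
  case empty
  then show ?case by (simp add: Poi_def)
next
  case (insert v B)
  have upd: "sum (Z(v := n)) B = sum Z B" for Z :: "'a \<Rightarrow> nat" and n
    using insert.hyps by (intro sum.cong) auto
  have "map_pmf (\<lambda>Z. \<Sum>v\<in>insert v B. Z v) (Pi_pmf (insert v B) 0 (\<lambda>v. Poi (r v))) =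
      map_pmf (\<lambda>(n, Z). n + (\<Sum>u\<in>B. Z u)) (pair_pmf (Poi (r v)) (Pi_pmf B 0 (\<lambda>v. Poi (r v))))"
    using insert.hyps
    by (simp add: Pi_pmf_insert pmf.map_comp o_def case_prod_unfold upd fun_upd_same del: fun_upd_apply)
  also have "\<dots> = map_pmf (\<lambda>(n, m). n + m)
      (pair_pmf (Poi (r v)) (map_pmf (\<lambda>Z. \<Sum>u\<in>B. Z u) (Pi_pmf B 0 (\<lambda>v. Poi (r v)))))"
    by (simp add: pair_map_pmf2 pmf.map_comp o_def case_prod_unfold)
  also have "\<dots> = Poi (r v + (\<Sum>u\<in>B. r u))"
    using insert by (simp add: Poi_add sum_nonneg)
  finally show ?case using insert.hyps by simp
qed

text \<open>Sums over disjoint blocks of independent Poisson variables are again independent and Poisson.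
  This is the independence of increments of a Poisson process.\<close>
lemma map_block_sums_Pi_pmf_Poi:
  fixes B :: "nat \<Rightarrow> 'a set"
  assumes "finite J" "\<And>v. v \<in> J \<Longrightarrow> r v \<ge> 0" "\<And>i. i < n \<Longrightarrow> B i \<subseteq> J"
    and "\<And>i j. i < j \<Longrightarrow> j < n \<Longrightarrow> B i \<inter> B j = {}"
  shows "map_pmf (\<lambda>Z i. if i < n then \<Sum>v\<in>B i. Z v else 0) (Pi_pmf J 0 (\<lambda>v. Poi (r v))) =
    Pi_pmf {..<n} 0 (\<lambda>i. Poi (\<Sum>v\<in>B i. r v))"
  using assms
proof (induction n arbitrary: J)
  case 0
  then show ?case by simp
next
  case (Suc n)
  let ?P = "\<lambda>J. Pi_pmf J 0 (\<lambda>v. Poi (r v))"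
  define J' where "J' = J - B n"
  have J: "J = B n \<union> J'" "B n \<inter> J' = {}" "finite (B n)" "finite J'"
    using Suc.prems by (auto simp: J'_def intro: finite_subset)
  have sub: "B i \<subseteq> J'" if "i < n" for i
    using Suc.prems(3) [of i] Suc.prems(4) [of i n] that by (auto simp: J'_def)
  have glue: "(\<lambda>i. if i < Suc n then \<Sum>v\<in>B i. (if v \<in> B n then Y v else Z v) else 0) =
      (\<lambda>i. if i < n then \<Sum>v\<in>B i. Z v else 0)(n := \<Sum>v\<in>B n. Y v)" for Y Z :: "'a \<Rightarrow> nat"
  proof
    fix i
    have "(\<Sum>v\<in>B i. if v \<in> B n then Y v else Z v) = (\<Sum>v\<in>B i. Z v)" if "i < n"
      using sub [OF that] J(2) by (intro sum.cong) auto
    then show "(if i < Suc n then \<Sum>v\<in>B i. (if v \<in> B n then Y v else Z v) else 0) =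
      ((\<lambda>i. if i < n then \<Sum>v\<in>B i. Z v else 0)(n := \<Sum>v\<in>B n. Y v)) i"
      by (cases i n rule: linorder_cases) auto
  qed
  have "map_pmf (\<lambda>Z i. if i < Suc n then \<Sum>v\<in>B i. Z v else 0) (?P J) =
      map_pmf (\<lambda>(Y, Z). (\<lambda>i. if i < n then \<Sum>v\<in>B i. Z v else 0)(n := \<Sum>v\<in>B n. Y v))
        (pair_pmf (?P (B n)) (?P J'))"
    unfolding J(1) Pi_pmf_union [OF J(3) J(4) J(2)]
    by (simp add: pmf.map_comp o_def case_prod_unfold glue del: fun_upd_apply)
  also have "\<dots> = map_pmf (\<lambda>(m, f). f(n := m)) (pair_pmf (map_pmf (\<lambda>Y. \<Sum>v\<in>B n. Y v) (?P (B n)))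
      (map_pmf (\<lambda>Z i. if i < n then \<Sum>v\<in>B i. Z v else 0) (?P J')))"
    by (simp add: pair_map_pmf1 pair_map_pmf2 pmf.map_comp o_def case_prod_unfold)
  also have "map_pmf (\<lambda>Y. \<Sum>v\<in>B n. Y v) (?P (B n)) = Poi (\<Sum>v\<in>B n. r v)"
    using J Suc.prems(2) by (intro map_sum_Pi_pmf_Poi) auto
  also have "map_pmf (\<lambda>Z i. if i < n then \<Sum>v\<in>B i. Z v else 0) (?P J') =
      Pi_pmf {..<n} 0 (\<lambda>i. Poi (\<Sum>v\<in>B i. r v))"
    using Suc.prems J(4) sub by (intro Suc.IH) (auto simp: J'_def)
  finally show ?case by (simp add: lessThan_Suc Pi_pmf_insert del: fun_upd_apply)
qed

text \<open>The distance from \<open>v\<close> to its predecessor in \<open>V\<close>. At the least element of \<open>V\<close> the value is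
  arbitrary, so sums of gaps are taken only over elements above some element of \<open>V\<close>.\<close>
definition gap :: "real set \<Rightarrow> real \<Rightarrow> real" where
  "gap V v = v - Max {u\<in>V. u < v}"

lemma sum_gap:
  assumes "finite V" "a \<in> V" "b \<in> V" "a \<le> b"
  shows "(\<Sum>v\<in>{v\<in>V. a < v \<and> v \<le> b}. gap V v) = b - a"
  using assms
proof (induction V arbitrary: b rule: finite_linorder_max_induct)
  case empty
  then show ?case by simp
next
  case (insert w V)
  have gap: "gap (insert w V) v = gap V v" if "v \<in> V" for v
  proof -
    have "{u \<in> insert w V. u < v} = {u \<in> V. u < v}" using insert.hyps that by auto
    then show ?thesis by (simp add: gap_def)
  qed
  have old: "(\<Sum>v\<in>{v\<in>V. a < v \<and> v \<le> b}. gap (insert w V) v) = b - a"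
    if "a \<in> V" "b \<in> V" "a \<le> b" for b
    using insert.IH [OF that] gap by simp
  consider "b \<in> V" | "b = w" "a = w" | "b = w" "a \<in> V" using insert.prems by auto
  then show ?case
  proof cases
    case 1
    then have "a \<in> V" using insert by force
    moreover have "{v \<in> insert w V. a < v \<and> v \<le> b} = {v\<in>V. a < v \<and> v \<le> b}"
      using 1 insert.hyps by force
    ultimately show ?thesis using old 1 insert.prems by simp
  next
    case 2
    then have "{v \<in> insert w V. a < v \<and> v \<le> b} = {}" by auto
    then show ?thesis using 2 by (simp only: sum.empty)
  next
    case 3
    define u where "u = Max V"
    have u: "u \<in> V" "\<And>v. v \<in> V \<Longrightarrow> v \<le> u"
      using 3 insert.hyps by (auto simp: u_def intro!: Max_in)
    have split: "{v \<in> insert w V. a < v \<and> v \<le> b} = insert w {v\<in>V. a < v \<and> v \<le> u}"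
      using 3 insert.hyps u by force
    have "{v \<in> insert w V. v < w} = V" using insert.hyps by auto
    then have "gap (insert w V) w = w - u" by (simp add: gap_def u_def)
    moreover have "w \<notin> V" using insert.hyps by auto
    ultimately show ?thesis
      unfolding split using insert.hyps 3 u old [of u] by simp
  qed
qed

lemma gap_nonneg:
  assumes "finite V" "u \<in> V" "u < v"
  shows "gap V v \<ge> 0"
  proof -
  have "Max {u\<in>V. u < v} \<in> {u\<in>V. u < v}" using assms by (intro Max_in) auto
  then show ?thesis by (simp add: gap_def)
qed

text \<open>The value at \<open>c\<close> of the Poisson process whose increment between neighbouring levels of \<open>V\<close> is
  the variable \<open>Z\<close> indexed by the upper one.\<close>
definition level_count :: "real set \<Rightarrow> (real \<Rightarrow> nat) \<Rightarrow> real \<Rightarrow> nat" where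
  "level_count V Z c = (\<Sum>v\<in>{v\<in>V. 0 < v \<and> v \<le> c}. Z v)"

lemma mono_level_count: "finite V \<Longrightarrow> mono (level_count V Z)"
  unfolding level_count_def by (intro monoI sum_mono2) auto

text \<open>The increments of that process along the chain of levels \<open>C 0, \<dots>, C n\<close>. Outside the \<open>n\<close> steps
  the value is 0, the default of the product law in \<open>level_arrivals_law\<close>.\<close>
definition level_arrivals :: "real set \<Rightarrow> (nat \<Rightarrow> real) \<Rightarrow> nat \<Rightarrow> (real \<Rightarrow> nat) \<Rightarrow> nat \<Rightarrow> nat" where
  "level_arrivals V C n Z i = (if i < n then \<Sum>v\<in>{v\<in>V. C i < v \<and> v \<le> C (Suc i)}. Z v else 0)"

lemma chain_mono:
  fixes C :: "nat \<Rightarrow> real"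
  assumes "\<And>i. i < n \<Longrightarrow> C i \<le> C (Suc i)" "i \<le> j" "j \<le> n"
  shows "C i \<le> C j"
  using assms(2,3)
proof (induction j rule: dec_induct)
  case (step j)
  then show ?case using assms(1) [of j] by force
qed simp

text \<open>Cumulative arrivals are the process evaluated at the current level. Since the process is
  monotone, taking minima or maxima commutes with passing from levels to cumulative arrivals.\<close>
lemma sum_level_arrivals:
  assumes "finite V" "C 0 = 0" "\<And>i. i < n \<Longrightarrow> C i \<le> C (Suc i)" "i \<le> n"
  shows "(\<Sum>j<i. level_arrivals V C n Z j) = level_count V Z (C i)"
  using assms(4)
proof (induction i)
  case 0
  have "{v\<in>V. 0 < v \<and> v \<le> C 0} = {}" using assms by auto
  then show ?case by (simp only: level_count_def) simp
next
  case (Suc i)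
  have C: "0 \<le> C i" "C i \<le> C (Suc i)"
    using chain_mono [of n C 0 i] assms Suc.prems by auto
  have "{v\<in>V. 0 < v \<and> v \<le> C (Suc i)} = {v\<in>V. 0 < v \<and> v \<le> C i} \<union> {v\<in>V. C i < v \<and> v \<le> C (Suc i)}"
    using C by auto
  moreover have "{v\<in>V. 0 < v \<and> v \<le> C i} \<inter> {v\<in>V. C i < v \<and> v \<le> C (Suc i)} = {}" by auto
  ultimately show ?case
    using Suc assms(1) by (simp add: level_count_def level_arrivals_def sum.union_disjoint)
qed

text \<open>One and the same family \<open>Z\<close> realizes the Poisson arrivals of every increasing chain of levels
  in \<open>V\<close>. This is the coupling used to compare policies.\<close>
lemma level_arrivals_law:
  assumes "finite V" "0 \<in> V" "C 0 = 0" "\<And>i. i < n \<Longrightarrow> C i \<le> C (Suc i)"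
    and "\<And>i. i \<le> n \<Longrightarrow> C i \<in> V"
  shows "map_pmf (level_arrivals V C n) (Pi_pmf {v\<in>V. 0 < v} 0 (\<lambda>v. Poi (gap V v))) =
    Pi_pmf {..<n} 0 (\<lambda>i. Poi (C (Suc i) - C i))"
proof -
  let ?B = "\<lambda>i. {v\<in>V. C i < v \<and> v \<le> C (Suc i)}"
  have nonneg: "0 \<le> C i" if "i \<le> n" for i
    using chain_mono [of n C 0 i] assms that by auto
  have "map_pmf (\<lambda>Z i. if i < n then \<Sum>v\<in>?B i. Z v else 0)
      (Pi_pmf {v\<in>V. 0 < v} 0 (\<lambda>v. Poi (gap V v))) =
    Pi_pmf {..<n} 0 (\<lambda>i. Poi (\<Sum>v\<in>?B i. gap V v))"
  proof (rule map_block_sums_Pi_pmf_Poi)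
    show "?B i \<subseteq> {v\<in>V. 0 < v}" if "i < n" for i
      using nonneg [of i] that by auto
    show "?B i \<inter> ?B j = {}" if "i < j" "j < n" for i j
      using chain_mono [of n C "Suc i" j] assms that by auto
  qed (use assms gap_nonneg [of V 0] in auto)
  also have "\<dots> = Pi_pmf {..<n} 0 (\<lambda>i. Poi (C (Suc i) - C i))"
    using assms by (intro Pi_pmf_cong) (auto simp: sum_gap)
  finally show ?thesis by (simp add: level_arrivals_def [abs_def])
qed

section \<open>Submodularity of the mean queue\<close>

lemma integrable_queue_law:
  fixes a :: "nat \<Rightarrow> nat pmf"
  assumes "\<And>i. i < n \<Longrightarrow> integrable (a i) real"
  shows "integrable (pair_pmf (Pi_pmf {..<n} 0 a) q) (\<lambda>z. real (queue x (fst z) (k (snd z)) n))"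
proof (rule Bochner_Integration.integrable_bound)
  let ?P = "pair_pmf (Pi_pmf {..<n} 0 a) q"
  have "integrable ?P (\<lambda>z. real (fst z i))" if "i < n" for i
  proof -
    have "map_pmf (\<lambda>z. fst z i) ?P = map_pmf (\<lambda>e. e i) (map_pmf fst ?P)"
      by (simp only: pmf.map_comp o_def)
    also have "\<dots> = a i"
      using that by (simp add: map_fst_pair_pmf Pi_pmf_component)
    finally have "integrable (map_pmf (\<lambda>z. fst z i) ?P) real"
      using assms [OF that] by simp
    then show ?thesis by (simp only: integrable_map_pmf_eq)
  qed
  then show "integrable ?P (\<lambda>z. real x + (\<Sum>i<n. real (fst z i)))"
    by (intro Bochner_Integration.integrable_add Bochner_Integration.integrable_sum) auto
  show "AE z in ?P. norm (real (queue x (fst z) (k (snd z)) n)) \<le>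
      norm (real x + (\<Sum>i<n. real (fst z i)))"
  proof (rule AE_I2)
    fix z
    have "real (queue x (fst z) (k (snd z)) n) \<le> real (x + (\<Sum>i<n. fst z i))"
      by (intro of_nat_mono queue_le)
    then show "norm (real (queue x (fst z) (k (snd z)) n)) \<le> norm (real x + (\<Sum>i<n. real (fst z i)))"
      by simp
  qed
qed simp

definition mean_queue :: "(nat \<Rightarrow> nat pmf) \<Rightarrow> nat pmf \<Rightarrow> nat \<Rightarrow> nat \<Rightarrow> real" where
  "mean_queue a \<kappa> n x = (\<integral>y. real y \<partial>queue_law a \<kappa> x n)"

lemma mean_queue_eq:
  "mean_queue a \<kappa> n x = (\<integral>z. real (queue x (fst z) (snd z) n)
     \<partial>pair_pmf (Pi_pmf {..<n} 0 a) (Pi_pmf {..<n} 0 (\<lambda>_. \<kappa>)))"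
  by (simp add: mean_queue_def queue_law_eq_map case_prod_beta)

lemma nn_integral_queue_law:
  fixes a :: "nat \<Rightarrow> nat pmf"
  assumes "\<And>i. i < n \<Longrightarrow> integrable (a i) real"
  shows "(\<integral>\<^sup>+y. ennreal (real y) \<partial>queue_law a \<kappa> x n) = ennreal (mean_queue a \<kappa> n x)"
  unfolding mean_queue_eq queue_law_eq_map
  using nn_integral_eq_integral [OF integrable_queue_law [where k = "\<lambda>k. k"], OF assms]
  by (simp add: case_prod_beta)

lemma mean_queue_Suc_start:
  fixes a :: "nat \<Rightarrow> nat pmf"
  assumes "\<And>i. i < n \<Longrightarrow> integrable (a i) real"
  shows "\<bar>mean_queue a \<kappa> n (Suc x) - mean_queue a \<kappa> n x\<bar> \<le> 1"
proof -
  let ?P = "pair_pmf (Pi_pmf {..<n} 0 a) (Pi_pmf {..<n} 0 (\<lambda>_. \<kappa>))"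
  note int = integrable_queue_law [where k = "\<lambda>k. k", OF assms]
  have le: "real (queue x (fst z) (snd z) n) \<le> real (queue (Suc x) (fst z) (snd z) n)"
    "real (queue (Suc x) (fst z) (snd z) n) \<le> real (queue x (fst z) (snd z) n) + 1"
    for z :: "(nat \<Rightarrow> nat) \<times> (nat \<Rightarrow> nat)"
    using queue_Suc_start [of x "fst z" "snd z" n] by linarith+
  have "mean_queue a \<kappa> n x \<le> mean_queue a \<kappa> n (Suc x)"
    unfolding mean_queue_eq by (rule integral_mono [OF int int le(1)])
  moreover have "mean_queue a \<kappa> n (Suc x) \<le> (\<integral>z. real (queue x (fst z) (snd z) n) + 1 \<partial>?P)"
    unfolding mean_queue_eq
    by (rule integral_mono [OF int _ le(2)]) (auto intro!: Bochner_Integration.integrable_add int)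
  moreover have "(\<integral>z. real (queue x (fst z) (snd z) n) + 1 \<partial>?P) = mean_queue a \<kappa> n x + 1"
    unfolding mean_queue_eq by (subst Bochner_Integration.integral_add) (auto intro!: int)
  ultimately show ?thesis by simp
qed

lemma mean_queue_cong:
  assumes "\<And>i. i < n \<Longrightarrow> a i = a' i"
  shows "mean_queue a \<kappa> n x = mean_queue a' \<kappa> n x"
proof -
  have "Pi_pmf {..<n} 0 a = Pi_pmf {..<n} 0 a'" using assms by (intro Pi_pmf_cong) auto
  then show ?thesis by (simp add: mean_queue_eq)
qed

text \<open>All four arrival streams are realized on one probability space \<open>P\<close>, where the pathwise
  inequality \<open>queue_submodular\<close> applies and can be integrated.\<close>
theorem mean_queue_submodular:
  fixes C C' Cmin Cmax :: "nat \<Rightarrow> real" and \<kappa> :: "nat pmf" and n x :: nat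
  defines "Q \<equiv> \<lambda>C. mean_queue (\<lambda>i. Poi (C (Suc i) - C i)) \<kappa> n x"
  assumes zero: "C 0 = 0" "C' 0 = 0"
    and incr: "\<And>i. i < n \<Longrightarrow> C i \<le> C (Suc i)" "\<And>i. i < n \<Longrightarrow> C' i \<le> C' (Suc i)"
    and min: "\<And>i. i \<le> n \<Longrightarrow> Cmin i = min (C i) (C' i)"
    and max: "\<And>i. i \<le> n \<Longrightarrow> Cmax i = max (C i) (C' i)"
  shows "Q Cmin + Q Cmax \<le> Q C + Q C'"
proof -
  define V where "V = insert 0 (C ` {..n} \<union> C' ` {..n})"
  define W where "W = Pi_pmf {v\<in>V. 0 < v} 0 (\<lambda>v. Poi (gap V v))"
  define P where "P = pair_pmf W (Pi_pmf {..<n} 0 (\<lambda>_. \<kappa>))"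
  define X where "X D z = real (queue x (level_arrivals V D n (fst z)) (snd z) n)"
    for D and z :: "(real \<Rightarrow> nat) \<times> (nat \<Rightarrow> nat)"
  have V: "finite V" "0 \<in> V" by (auto simp: V_def)
  define chain where "chain D \<longleftrightarrow> D 0 = 0 \<and> (\<forall>i<n. D i \<le> D (Suc i)) \<and> (\<forall>i\<le>n. D i \<in> V)" for D
  have chains: "chain C" "chain C'" "chain Cmin" "chain Cmax"
  proof -
    show "chain C" "chain C'" using zero incr by (auto simp: chain_def V_def)
    have "min (C i) (C' i) \<in> V" "max (C i) (C' i) \<in> V" if "i \<le> n" for i
      using that by (auto simp: V_def min_def max_def)
    moreover have "Cmin i \<le> Cmin (Suc i)" "Cmax i \<le> Cmax (Suc i)" if "i < n" for i
      using that incr [of i] by (auto simp: min max intro!: min.mono max.mono)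
    ultimately show "chain Cmin" "chain Cmax"
      by (simp_all add: chain_def min max zero)
  qed
  have realize: "integrable P (X D) \<and> Q D = (\<integral>z. X D z \<partial>P)" if "chain D" for D
  proof -
    let ?K = "Pi_pmf {..<n} 0 (\<lambda>_. \<kappa>)" and ?a = "\<lambda>i. Poi (D (Suc i) - D i)"
    let ?f = "\<lambda>z. real (queue x (fst z) (snd z) n)"
    have "Pi_pmf {..<n} 0 ?a = map_pmf (level_arrivals V D n) W"
      unfolding W_def
      using that V by (intro level_arrivals_law [symmetric]) (auto simp: chain_def)
    then have law: "pair_pmf (Pi_pmf {..<n} 0 ?a) ?K =
        map_pmf (\<lambda>z. (level_arrivals V D n (fst z), snd z)) P"
      by (simp add: P_def pair_map_pmf1 case_prod_unfold apfst_def map_prod_def)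
    have "integrable (pair_pmf (Pi_pmf {..<n} 0 ?a) ?K) ?f"
      using that by (intro integrable_queue_law [where k = "\<lambda>k. k"] integrable_Poi) (auto simp: chain_def)
    then have "integrable P (X D)" unfolding law by (simp add: X_def [abs_def])
    moreover have "Q D = (\<integral>z. X D z \<partial>P)"
      unfolding Q_def mean_queue_eq law by (simp add: X_def)
    ultimately show ?thesis by blast
  qed
  have count: "(\<Sum>j<i. level_arrivals V D n Z j) = level_count V Z (D i)"
    if "chain D" "i \<le> n" for D i Z
    using that V by (intro sum_level_arrivals) (auto simp: chain_def)
  have "X Cmin z + X Cmax z \<le> X C z + X C' z" for z
  proof -
    let ?N = "level_count V (fst z)"
    have "queue x (level_arrivals V Cmin n (fst z)) (snd z) n
        + queue x (level_arrivals V Cmax n (fst z)) (snd z) n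
      \<le> queue x (level_arrivals V C n (fst z)) (snd z) n
        + queue x (level_arrivals V C' n (fst z)) (snd z) n"
    proof (rule queue_submodular)
      fix i assume i: "i \<le> n"
      show "(\<Sum>j<i. level_arrivals V Cmin n (fst z) j) = min
          (\<Sum>j<i. level_arrivals V C n (fst z) j) (\<Sum>j<i. level_arrivals V C' n (fst z) j)"
        using i mono_level_count [OF V(1)] by (simp add: count chains min min_of_mono)
      show "(\<Sum>j<i. level_arrivals V Cmax n (fst z) j) = max
          (\<Sum>j<i. level_arrivals V C n (fst z) j) (\<Sum>j<i. level_arrivals V C' n (fst z) j)"
        using i mono_level_count [OF V(1)] by (simp add: count chains max max_of_mono)
    qed
    then show ?thesis by (simp add: X_def flip: of_nat_add)
  qed
  then have "(\<integral>z. X Cmin z + X Cmax z \<partial>P) \<le> (\<integral>z. X C z + X C' z \<partial>P)"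
    using realize chains by (intro integral_mono Bochner_Integration.integrable_add) auto
  then show ?thesis using realize chains by simp
qed

section \<open>Geometric convergence under negative drift\<close>

text \<open>The capacity may have infinite mean. Truncating it keeps the drift negative and leaves a finite
  sum, which can be differentiated.\<close>
lemma truncated_mean_exceeds:
  fixes \<kappa> :: "nat pmf"
  assumes "ennreal r < (\<integral>\<^sup>+k. ennreal (real k) \<partial>\<kappa>)"
  shows "\<exists>M. r < (\<Sum>j\<le>M. real j * pmf (map_pmf (min M) \<kappa>) j)"
proof -
  have sup: "(SUP M. ennreal (real (min M k))) = ennreal (real k)" for k
  proof (rule antisym)
    show "(SUP M. ennreal (real (min M k))) \<le> ennreal (real k)"
      by (rule SUP_least) (simp add: ennreal_leI)
    show "ennreal (real k) \<le> (SUP M. ennreal (real (min M k)))"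
      by (rule SUP_upper2 [of k]) auto
  qed
  have "(\<integral>\<^sup>+k. ennreal (real k) \<partial>\<kappa>) = (SUP M. \<integral>\<^sup>+k. ennreal (real (min M k)) \<partial>\<kappa>)"
    by (subst nn_integral_monotone_convergence_SUP [symmetric])
      (auto simp: sup incseq_def le_fun_def intro!: ennreal_leI)
  with assms obtain M where M: "ennreal r < (\<integral>\<^sup>+k. ennreal (real (min M k)) \<partial>\<kappa>)"
    by (auto simp: less_SUP_iff)
  have int: "integrable \<kappa> (\<lambda>k. real (min M k))"
    by (rule measure_pmf.integrable_const_bound [where B = "real M"]) auto
  have "(\<integral>\<^sup>+k. ennreal (real (min M k)) \<partial>\<kappa>) = ennreal (\<integral>k. real (min M k) \<partial>\<kappa>)"
    by (rule nn_integral_eq_integral [OF int]) auto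
  with M have "ennreal r < ennreal (\<integral>k. real (min M k) \<partial>\<kappa>)" by (simp only:)
  then have "r < (\<integral>k. real (min M k) \<partial>\<kappa>)" by (meson ennreal_leI not_less)
  also have "\<dots> = (\<integral>j. real j \<partial>map_pmf (min M) \<kappa>)" by simp
  also have "\<dots> = (\<Sum>j\<le>M. real j * pmf (map_pmf (min M) \<kappa>) j)"
    by (rule integral_measure_pmf_real) auto
  finally show ?thesis by blast
qed

text \<open>With the truncated capacity, the generating function \<open>h\<close> of demand minus capacity has the
  value 1 and the negative drift as its derivative at 1, so it drops below 1 just to the right.
  Truncation only increases it.\<close>
lemma negative_drift_exponential:
  fixes \<kappa> :: "nat pmf"
  assumes "r > 0" "ennreal r < (\<integral>\<^sup>+k. ennreal (real k) \<partial>\<kappa>)"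
  obtains \<theta> \<phi> :: real where "\<theta> > 1" "0 \<le> \<phi>" "\<phi> < 1"
    "(\<integral>\<^sup>+z. ennreal (\<theta> ^ fst z / \<theta> ^ snd z) \<partial>pair_pmf (Poi r) \<kappa>) = ennreal \<phi>"
proof -
  from truncated_mean_exceeds [OF assms(2)]
  obtain M where M: "r < (\<Sum>j\<le>M. real j * pmf (map_pmf (min M) \<kappa>) j)" by blast
  define q where "q = pmf (map_pmf (min M) \<kappa>)"
  define h where "h s = exp (r * (s - 1)) * (\<Sum>j\<le>M. inverse s ^ j * q j)" for s :: real
  have mass: "(\<Sum>j\<le>M. q j) = 1"
    unfolding q_def by (rule sum_pmf_eq_1) auto
  have "(h has_real_derivative
      exp (r * (1 - 1)) * r * (\<Sum>j\<le>M. inverse 1 ^ j * q j) +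
      exp (r * (1 - 1)) * (\<Sum>j\<le>M. - real j * q j)) (at 1)"
    unfolding h_def
    by (auto intro!: derivative_eq_intros DERIV_sum sum.cong
        simp: sum_distrib_left sum_subtractf sum_negf)
  then have "(h has_real_derivative (r - (\<Sum>j\<le>M. real j * q j))) (at 1)"
    by (simp add: mass sum_negf sum_subtractf)
  moreover have "r - (\<Sum>j\<le>M. real j * q j) < 0" using M by (simp add: q_def)
  ultimately obtain d where d: "d > 0" "\<And>s. 0 < s \<Longrightarrow> s < d \<Longrightarrow> h (1 + s) < h 1"
    using DERIV_neg_dec_right by blast
  define \<theta> where "\<theta> = 1 + d / 2"
  have \<theta>: "\<theta> > 1" "h \<theta> < 1"
    using d(1) d(2) [of "d / 2"] mass by (auto simp: \<theta>_def h_def)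
  have trunc: "(\<integral>\<^sup>+k. ennreal (inverse \<theta> ^ min M k) \<partial>\<kappa>) = ennreal (\<Sum>j\<le>M. inverse \<theta> ^ j * q j)"
  proof -
    have "integrable \<kappa> (\<lambda>k. inverse \<theta> ^ min M k)"
      by (rule measure_pmf.integrable_const_bound [where B = 1])
        (use \<theta> in \<open>auto simp: power_le_one inverse_le_1_iff\<close>)
    then have "(\<integral>\<^sup>+k. ennreal (inverse \<theta> ^ min M k) \<partial>\<kappa>) = ennreal (\<integral>k. inverse \<theta> ^ min M k \<partial>\<kappa>)"
      using \<theta> by (intro nn_integral_eq_integral) auto
    also have "(\<integral>k. inverse \<theta> ^ min M k \<partial>\<kappa>) = (\<integral>j. inverse \<theta> ^ j \<partial>map_pmf (min M) \<kappa>)" by simp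
    also have "\<dots> = (\<Sum>j\<le>M. inverse \<theta> ^ j * q j)"
      unfolding q_def by (rule integral_measure_pmf_real) auto
    finally show ?thesis .
  qed
  let ?I = "\<integral>\<^sup>+z. ennreal (\<theta> ^ fst z / \<theta> ^ snd z) \<partial>pair_pmf (Poi r) \<kappa>"
  have "?I = (\<integral>\<^sup>+d. (\<integral>\<^sup>+k. ennreal (\<theta> ^ d) * ennreal (inverse \<theta> ^ k) \<partial>\<kappa>) \<partial>Poi r)"
    using \<theta> by (simp add: nn_integral_pair_pmf' ennreal_mult [symmetric] divide_inverse power_inverse)
  also have "\<dots> = ennreal (exp (r * (\<theta> - 1))) * (\<integral>\<^sup>+k. ennreal (inverse \<theta> ^ k) \<partial>\<kappa>)"
    using assms \<theta> by (simp add: nn_integral_cmult nn_integral_multc nn_integral_power_Poi)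
  also have "\<dots> \<le> ennreal (exp (r * (\<theta> - 1))) * (\<integral>\<^sup>+k. ennreal (inverse \<theta> ^ min M k) \<partial>\<kappa>)"
    using \<theta> by (intro mult_left_mono nn_integral_mono ennreal_leI power_decreasing)
      (auto simp: inverse_le_1_iff)
  also have "\<dots> = ennreal (h \<theta>)"
    using \<theta> unfolding trunc h_def
    by (subst ennreal_mult) (auto intro!: sum_nonneg simp: q_def)
  finally have le: "?I \<le> ennreal (h \<theta>)" .
  then have "?I < top" using ennreal_less_top le_less_trans by blast
  then obtain \<phi> where \<phi>: "0 \<le> \<phi>" "?I = ennreal \<phi>" by (cases ?I) auto
  have q_nonneg: "0 \<le> q j" for j by (simp add: q_def)
  have "0 \<le> h \<theta>"
    unfolding h_def by (intro mult_nonneg_nonneg sum_nonneg) (use \<theta> q_nonneg in auto)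
  with le \<phi> have "\<phi> \<le> h \<theta>" by simp
  with \<theta>(2) have "\<phi> < 1" by simp
  with \<phi> \<theta> that show thesis by blast
qed

definition mean_step :: "nat pmf \<Rightarrow> nat pmf \<Rightarrow> (nat \<Rightarrow> real) \<Rightarrow> nat \<Rightarrow> real" where
  "mean_step a \<kappa> f x = (\<integral>z. f (x + fst z - snd z) \<partial>pair_pmf a \<kappa>)"

lemma exponential_growth:
  fixes f :: "nat \<Rightarrow> real"
  assumes "\<theta> > 1" "\<And>x. \<bar>f (Suc x) - f x\<bar> \<le> c * \<theta> ^ x"
  shows "\<bar>f y - f x\<bar> \<le> c * (\<theta> ^ x + \<theta> ^ y) / (\<theta> - 1)"
proof -
  have c: "c \<ge> 0" using assms(2) [of 0] by simp
  have upward: "\<bar>f y - f x\<bar> \<le> c * (\<theta> ^ y - \<theta> ^ x) / (\<theta> - 1)" if "x \<le> y" for x y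
    using that
  proof (induction y rule: dec_induct)
    case base
    then show ?case by simp
  next
    case (step y)
    have "\<bar>f (Suc y) - f x\<bar> \<le> c * \<theta> ^ y + c * (\<theta> ^ y - \<theta> ^ x) / (\<theta> - 1)"
      using assms(2) [of y] step.IH by linarith
    also have "\<dots> = c * (\<theta> ^ Suc y - \<theta> ^ x) / (\<theta> - 1)"
      using assms(1) by (simp add: field_simps)
    finally show ?case .
  qed
  have bound: "c * (\<theta> ^ y - \<theta> ^ x) / (\<theta> - 1) \<le> c * (\<theta> ^ x + \<theta> ^ y) / (\<theta> - 1)" for x y
    using assms(1) c by (intro divide_right_mono mult_left_mono) auto
  show ?thesis
  proof (cases "x \<le> y")
    case True
    then show ?thesis using upward [of x y] bound [of y x] by simp
  next
    case False
    then show ?thesis using upward [of y x] bound [of x y] by (simp add: abs_minus_commute add.commute)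
  qed
qed

lemma abs_expectation_le:
  fixes f g :: "'a \<Rightarrow> real"
  assumes "integrable M f" "integrable M g" "\<And>x. \<bar>f x\<bar> \<le> g x"
  shows "\<bar>\<integral>x. f x \<partial>M\<bar> \<le> (\<integral>x. g x \<partial>M)"
  using assms by (intro order_trans [OF integral_abs_bound] integral_mono integrable_abs) auto

text \<open>After one step two queues started at \<open>Suc x\<close> and \<open>x\<close> are still one unit apart if the capacity
  used does not exceed \<open>x\<close> plus the demand, and coincide otherwise. Measuring increments of \<open>f\<close>
  against \<open>\<theta> ^ x\<close>, the surviving case costs the factor \<open>\<theta> ^ (d - k)\<close>, whose mean is \<open>\<phi>\<close>. The
  last claim bounds a single step, so that it sums geometrically along the iteration.\<close>
lemma mean_step_contraction:
  fixes f :: "nat \<Rightarrow> real"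
  assumes \<theta>: "\<theta> > 1"
    and up: "integrable (pair_pmf a \<kappa>) (\<lambda>z. \<theta> ^ fst z)"
    and drift: "integrable (pair_pmf a \<kappa>) (\<lambda>z. \<theta> ^ fst z / \<theta> ^ snd z)"
      "(\<integral>z. \<theta> ^ fst z / \<theta> ^ snd z \<partial>pair_pmf a \<kappa>) = \<phi>"
    and f: "\<And>x. \<bar>f (Suc x) - f x\<bar> \<le> c * \<theta> ^ x"
  shows "integrable (pair_pmf a \<kappa>) (\<lambda>z. f (x + fst z - snd z))"
    and "\<bar>mean_step a \<kappa> f (Suc x) - mean_step a \<kappa> f x\<bar> \<le> (c * \<phi>) * \<theta> ^ x"
    and "\<bar>mean_step a \<kappa> f x - f x\<bar>
      \<le> c * (\<theta> ^ x * (1 + (\<integral>z. \<theta> ^ fst z \<partial>pair_pmf a \<kappa>)) / (\<theta> - 1))"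
proof -
  let ?P = "pair_pmf a \<kappa>"
  have c: "c \<ge> 0" using f [of 0] by simp
  have dev: "\<bar>f (x + fst z - snd z) - f x\<bar> \<le> c * (\<theta> ^ x * (1 + \<theta> ^ fst z) / (\<theta> - 1))" for x and z :: "nat \<times> nat"
  proof -
    have "\<bar>f (x + fst z - snd z) - f x\<bar> \<le> c * (\<theta> ^ x + \<theta> ^ (x + fst z - snd z)) / (\<theta> - 1)"
      using \<theta> f by (rule exponential_growth)
    also have "\<dots> \<le> c * (\<theta> ^ x + \<theta> ^ (x + fst z)) / (\<theta> - 1)"
      using \<theta> c by (intro divide_right_mono mult_left_mono add_left_mono power_increasing) auto
    finally show ?thesis by (simp add: power_add algebra_simps)
  qed
  have int_dev: "integrable ?P (\<lambda>z. c * (\<theta> ^ x * (1 + \<theta> ^ fst z) / (\<theta> - 1)))" for x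
    using up by (intro integrable_mult_right integrable_divide Bochner_Integration.integrable_add) auto
  have int_diff: "integrable ?P (\<lambda>z. f (x + fst z - snd z) - f x)" for x
  proof (rule Bochner_Integration.integrable_bound [OF int_dev [of x]])
    show "AE z in ?P. norm (f (x + fst z - snd z) - f x) \<le> norm (c * (\<theta> ^ x * (1 + \<theta> ^ fst z) / (\<theta> - 1)))"
      unfolding real_norm_def by (intro AE_I2 order_trans [OF dev abs_ge_self])
  qed simp
  show int: "integrable ?P (\<lambda>z. f (x + fst z - snd z))" for x
  proof -
    have "integrable ?P (\<lambda>z. (f (x + fst z - snd z) - f x) + f x)"
      by (intro Bochner_Integration.integrable_add int_diff) simp
    then show ?thesis by simp
  qed
  have "\<bar>mean_step a \<kappa> f (Suc x) - mean_step a \<kappa> f x\<bar> =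
      \<bar>\<integral>z. f (Suc x + fst z - snd z) - f (x + fst z - snd z) \<partial>?P\<bar>"
    unfolding mean_step_def by (simp add: int del: add_Suc)
  also have "\<dots> \<le> (\<integral>z. (c * \<theta> ^ x) * (\<theta> ^ fst z / \<theta> ^ snd z) \<partial>?P)"
  proof (rule abs_expectation_le)
    show "integrable ?P (\<lambda>z. f (Suc x + fst z - snd z) - f (x + fst z - snd z))"
      by (intro Bochner_Integration.integrable_diff int)
    show "integrable ?P (\<lambda>z. (c * \<theta> ^ x) * (\<theta> ^ fst z / \<theta> ^ snd z))"
      by (intro integrable_mult_right drift)
    fix z :: "nat \<times> nat"
    show "\<bar>f (Suc x + fst z - snd z) - f (x + fst z - snd z)\<bar> \<le> (c * \<theta> ^ x) * (\<theta> ^ fst z / \<theta> ^ snd z)"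
      \<comment> \<open>In the second case both queues are empty and the left-hand side vanishes.\<close>
    proof (cases "snd z \<le> x + fst z")
      case True
      then have "\<theta> ^ (x + fst z - snd z) = \<theta> ^ x * (\<theta> ^ fst z / \<theta> ^ snd z)"
        using \<theta> by (simp add: power_diff power_add)
      then show ?thesis
        using f [of "x + fst z - snd z"] True by (simp add: Suc_diff_le mult.assoc)
    next
      case False
      then show ?thesis using \<theta> c by simp
    qed
  qed
  also have "\<dots> = (c * \<phi>) * \<theta> ^ x"
    by (subst integral_mult_right_zero) (simp only: drift(2) mult.assoc mult.commute)
  finally show "\<bar>mean_step a \<kappa> f (Suc x) - mean_step a \<kappa> f x\<bar> \<le> (c * \<phi>) * \<theta> ^ x" .
  have "\<bar>mean_step a \<kappa> f x - f x\<bar> = \<bar>\<integral>z. f (x + fst z - snd z) - f x \<partial>?P\<bar>"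
    unfolding mean_step_def by (simp add: int)
  also have "\<dots> \<le> (\<integral>z. c * (\<theta> ^ x * (1 + \<theta> ^ fst z) / (\<theta> - 1)) \<partial>?P)"
    by (rule abs_expectation_le [OF int_diff int_dev dev])
  also have "\<dots> = c * (\<theta> ^ x * (1 + (\<integral>z. \<theta> ^ fst z \<partial>?P)) / (\<theta> - 1))"
    by (subst integral_mult_right_zero, subst integral_divide_zero, subst integral_mult_right_zero,
        subst Bochner_Integration.integral_add) (use up in auto)
  finally show "\<bar>mean_step a \<kappa> f x - f x\<bar>
      \<le> c * (\<theta> ^ x * (1 + (\<integral>z. \<theta> ^ fst z \<partial>?P)) / (\<theta> - 1))" .
qed

text \<open>The iterates \<open>U n = (mean_step ^^ n) g\<close> have increments of order \<open>\<phi> ^ n\<close>, hence so have the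
  differences \<open>U (Suc n) x - U n x\<close>, and the sequence converges. The mean is given as an extended
  integral because \<open>g\<close> is unbounded; its finiteness is part of the claim.\<close>
lemma mean_queue_converges:
  fixes g :: "nat \<Rightarrow> real" and \<kappa> :: "nat pmf"
  assumes r: "r > 0" "ennreal r < (\<integral>\<^sup>+k. ennreal (real k) \<partial>\<kappa>)"
    and g: "\<And>x. 0 \<le> g x" "\<And>x. \<bar>g (Suc x) - g x\<bar> \<le> 1"
  obtains b where "\<And>n x. (\<integral>\<^sup>+y. ennreal (g y) \<partial>queue_law (\<lambda>_. Poi r) \<kappa> x n) = ennreal (b x n)"
    "\<And>x n. 0 \<le> b x n" "\<And>x. convergent (b x)"
proof -
  obtain \<theta> \<phi> where \<theta>: "\<theta> > 1" and \<phi>: "0 \<le> \<phi>" "\<phi> < 1" and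
    moment: "(\<integral>\<^sup>+z. ennreal (\<theta> ^ fst z / \<theta> ^ snd z) \<partial>pair_pmf (Poi r) \<kappa>) = ennreal \<phi>"
    using negative_drift_exponential [OF r] by blast
  let ?P = "pair_pmf (Poi r) \<kappa>"
  have up: "integrable ?P (\<lambda>z. \<theta> ^ fst z)"
  proof -
    have "integrable (map_pmf fst ?P) (\<lambda>d. \<theta> ^ d)"
      using r \<theta> by (simp add: map_fst_pair_pmf integrable_power_Poi del: integrable_map_pmf_eq)
    then show ?thesis by (simp only: integrable_map_pmf_eq)
  qed
  have drift: "integrable ?P (\<lambda>z. \<theta> ^ fst z / \<theta> ^ snd z)"
    using moment \<theta> by (intro integrableI_nonneg) auto
  have drift': "(\<integral>z. \<theta> ^ fst z / \<theta> ^ snd z \<partial>?P) = \<phi>"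
    using moment \<theta> \<phi> by (subst integral_eq_nn_integral) auto
  note contraction = mean_step_contraction [OF \<theta> up drift drift']
  define U where "U n = (mean_step (Poi r) \<kappa> ^^ n) g" for n
  have U_Suc: "U (Suc n) = mean_step (Poi r) \<kappa> (U n)" for n by (simp add: U_def)
  have U_incr: "\<bar>U n (Suc x) - U n x\<bar> \<le> \<phi> ^ n * \<theta> ^ x" for n x
  proof (induction n arbitrary: x)
    case 0
    have "1 \<le> \<theta> ^ x" using \<theta> by simp
    then show ?case using g(2) [of x] by (simp add: U_def)
  next
    case (Suc n)
    show ?case using contraction(2) [OF Suc.IH] by (simp add: U_Suc mult.commute)
  qed
  have U_nonneg: "0 \<le> U n x" for n x
    by (induction n arbitrary: x) (auto simp: U_def g mean_step_def)
  show thesis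
  proof (rule that [of "\<lambda>x n. U n x"])
    show "(\<integral>\<^sup>+y. ennreal (g y) \<partial>queue_law (\<lambda>_. Poi r) \<kappa> x n) = ennreal (U n x)" for x n
    proof (induction n arbitrary: x)
      case 0
      show ?case by (simp add: U_def)
    next
      case (Suc n)
      have "(\<integral>\<^sup>+y. ennreal (g y) \<partial>queue_law (\<lambda>_. Poi r) \<kappa> x (Suc n)) =
          (\<integral>\<^sup>+z. ennreal (U n (x + fst z - snd z)) \<partial>?P)"
        unfolding queue_law_Suc_first
        by (simp add: nn_integral_bind_pmf Suc.IH case_prod_beta del: queue_law.simps)
      also have "\<dots> = ennreal (U (Suc n) x)"
        unfolding U_Suc mean_step_def
        by (rule nn_integral_eq_integral [OF contraction(1) [OF U_incr]]) (auto simp: U_nonneg)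
      finally show ?case .
    qed
    show "0 \<le> U n x" for x n by (rule U_nonneg)
    show "convergent (\<lambda>n. U n x)" for x
    proof -
      have "summable (\<lambda>n. U (Suc n) x - U n x)"
      proof (rule summable_comparison_test')
        show "summable (\<lambda>n. \<phi> ^ n * (\<theta> ^ x * (1 + (\<integral>z. \<theta> ^ fst z \<partial>?P)) / (\<theta> - 1)))"
          using \<phi> by (intro summable_mult2 summable_geometric) auto
        show "norm (U (Suc n) x - U n x) \<le> \<phi> ^ n * (\<theta> ^ x * (1 + (\<integral>z. \<theta> ^ fst z \<partial>?P)) / (\<theta> - 1))"
          for n
          using contraction(3) [where f = "U n" and c = "\<phi> ^ n", OF U_incr] by (simp add: U_Suc)
      qed
      then have "convergent (\<lambda>n. \<Sum>i<n. U (Suc i) x - U i x)"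
        by (simp add: summable_iff_convergent)
      then have "convergent (\<lambda>n. U n x - U 0 x)"
        by (simp only: sum_lessThan_telescope [of "\<lambda>n. U n x"])
      from convergent_add [OF this convergent_const [of "U 0 x"]]
      have "convergent (\<lambda>n. (U n x - U 0 x) + U 0 x)" .
      then show ?thesis by simp
    qed
  qed
qed

lemma cesaro_mean_tendsto:
  fixes X :: "nat \<Rightarrow> real"
  assumes "X \<longlonglongrightarrow> L"
  shows "(\<lambda>n. (\<Sum>l<n. X l) / real n) \<longlonglongrightarrow> L"
proof (rule LIMSEQ_I)
  fix e :: real assume e: "e > 0"
  from LIMSEQ_D [OF assms, of "e / 2"] e obtain N where
    N: "\<And>n. n \<ge> N \<Longrightarrow> \<bar>X n - L\<bar> < e / 2" by auto
  define S where "S = (\<Sum>l<N. \<bar>X l - L\<bar>)"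
  obtain M :: nat where M: "2 * S / e < real M" using reals_Archimedean2 by blast
  have "\<bar>(\<Sum>l<n. X l) / real n - L\<bar> < e" if n: "n \<ge> N + M + 1" for n
  proof -
    have "\<bar>(\<Sum>l<n. X l) - real n * L\<bar> = \<bar>\<Sum>l<n. (X l - L)\<bar>"
      by (simp add: sum_subtractf)
    also have "\<dots> \<le> (\<Sum>l<n. \<bar>X l - L\<bar>)" by (rule sum_abs)
    also have "\<dots> = S + (\<Sum>l\<in>{N..<n}. \<bar>X l - L\<bar>)"
    proof -
      have "{..<n} = {..<N} \<union> {N..<n}" using n by auto
      have "{..<N} \<inter> {N..<n} = {}" by auto
      with \<open>{..<n} = {..<N} \<union> {N..<n}\<close> show ?thesis
        unfolding S_def by (simp add: sum.union_disjoint)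
    qed
    also have "\<dots> \<le> S + (\<Sum>l\<in>{N..<n}. e / 2)"
      by (intro add_left_mono sum_mono) (use N in \<open>auto intro: less_imp_le\<close>)
    also have "\<dots> \<le> S + real n * (e / 2)"
      using e by (simp add: of_nat_diff field_simps)
    also have "\<dots> < real n * e"
    proof -
      have "2 * S < e * real M" using M e by (simp add: field_simps)
      also have "\<dots> \<le> e * real n" using n e by simp
      finally show ?thesis by (simp add: field_simps)
    qed
    finally have "\<bar>(\<Sum>l<n. X l) - real n * L\<bar> < real n * e" .
    moreover have "(\<Sum>l<n. X l) / real n - L = ((\<Sum>l<n. X l) - real n * L) / real n"
      using n by (simp add: field_simps)
    ultimately show ?thesis using n by (simp add: abs_divide field_simps)
  qed
  then show "\<exists>no. \<forall>n\<ge>no. norm ((\<Sum>l<n. X l) / real n - L) < e" by auto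
qed

section \<open>Recursions driven by independent inputs\<close>

primrec history_law :: "(nat \<Rightarrow> 'a pmf) \<Rightarrow> nat \<Rightarrow> 'a list pmf" where
  "history_law L 0 = return_pmf []"
| "history_law L (Suc n) = map_pmf (\<lambda>(xs, x). xs @ [x]) (pair_pmf (history_law L n) (L n))"

lemma pmf_history_law:
  "pmf (history_law L n) ys = (if length ys = n then \<Prod>i<n. pmf (L i) (ys ! i) else 0)"
proof (induction n arbitrary: ys)
  case 0
  then show ?case by auto
next
  case (Suc n)
  have inj: "inj (\<lambda>(xs, x). xs @ [x :: 'a])" by (auto simp: inj_on_def)
  show ?case
  proof (cases ys rule: rev_cases)
    case Nil
    then show ?thesis by (auto intro!: pmf_map_outside)
  next
    case (snoc xs x)
    have "pmf (history_law L (Suc n)) ys = pmf (pair_pmf (history_law L n) (L n)) (xs, x)"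
      using pmf_map_inj' [OF inj, of "pair_pmf (history_law L n) (L n)" "(xs, x)"] snoc by simp
    then show ?thesis by (auto simp: pmf_pair Suc.IH snoc nth_append)
  qed
qed

text \<open>The first \<open>n\<close> coordinates under the infinite product form a discrete random list. Both sides
  assign to a singleton the measure of a cylinder set.\<close>
lemma distr_history:
  fixes L :: "nat \<Rightarrow> 'a::countable pmf"
  defines "M \<equiv> (\<Pi>\<^sub>M i\<in>UNIV. measure_pmf (L i))"
  shows measurable_history: "(\<lambda>\<omega>. map \<omega> [0..<n]) \<in> measurable M (count_space UNIV)"
    and "distr M (count_space UNIV) (\<lambda>\<omega>. map \<omega> [0..<n]) = measure_pmf (history_law L n)"
proof -
  define box where "box ys = {\<omega>\<in>space M. \<forall>i\<in>{..<n}. \<omega> i \<in> {ys ! i}}" for ys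
  have box: "box ys \<in> sets M" "emeasure M (box ys) = (\<Prod>i<n. emeasure (L i) {ys ! i})" for ys
  proof -
    have "product_prob_space (\<lambda>i. measure_pmf (L i))"
      by (intro product_prob_spaceI prob_space_measure_pmf)
    from product_prob_space.emeasure_PiM_Collect [OF this, of "{..<n}" UNIV "\<lambda>i. {ys ! i}"]
    show "emeasure M (box ys) = (\<Prod>i<n. emeasure (L i) {ys ! i})"
      unfolding box_def M_def by (simp only: subset_UNIV finite_lessThan sets_measure_pmf UNIV_I)
    show "box ys \<in> sets M"
      unfolding box_def M_def by (intro sets.sets_Collect_finite_All sets_Collect_single') simp_all
  qed
  have pre: "(\<lambda>\<omega>. map \<omega> [0..<n]) -` {ys} \<inter> space M = (if length ys = n then box ys else {})"
    for ys :: "'a list"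
  proof -
    have "map \<omega> [0..<n] = ys \<longleftrightarrow> length ys = n \<and> (\<forall>i<n. \<omega> i = ys ! i)" for \<omega>
      by (subst list_eq_iff_nth_eq) auto
    then show ?thesis unfolding box_def by auto
  qed
  show meas: "(\<lambda>\<omega>. map \<omega> [0..<n]) \<in> measurable M (count_space UNIV)"
  proof -
    have "(\<lambda>\<omega>. map \<omega> [0..<n]) -` {ys} \<inter> space M \<in> sets M" for ys
      unfolding pre using box(1) by simp
    then show ?thesis by (subst measurable_count_space_eq_countable) auto
  qed
  show "distr M (count_space UNIV) (\<lambda>\<omega>. map \<omega> [0..<n]) = measure_pmf (history_law L n)"
  proof (rule measure_eqI_countable [of _ UNIV])
    fix ys :: "'a list"
    have "emeasure (distr M (count_space UNIV) (\<lambda>\<omega>. map \<omega> [0..<n])) {ys} =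
        emeasure M ((\<lambda>\<omega>. map \<omega> [0..<n]) -` {ys} \<inter> space M)"
      by (rule emeasure_distr [OF meas]) simp
    also have "\<dots> = ennreal (pmf (history_law L n) ys)"
      unfolding pre pmf_history_law by (simp add: box(2) emeasure_pmf_single prod_ennreal)
    finally show "emeasure (distr M (count_space UNIV) (\<lambda>\<omega>. map \<omega> [0..<n])) {ys} =
        emeasure (measure_pmf (history_law L n)) {ys}"
      by (simp add: emeasure_pmf_single)
  qed simp_all
qed

primrec chain_law :: "(nat \<Rightarrow> 'a pmf) \<Rightarrow> (nat \<Rightarrow> 's \<Rightarrow> 'a \<Rightarrow> 's) \<Rightarrow> 's \<Rightarrow> nat \<Rightarrow> 's pmf" where
  "chain_law L F s 0 = return_pmf s"
| "chain_law L F s (Suc n) = bind_pmf (chain_law L F s n) (\<lambda>s'. map_pmf (F n s') (L n))"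

text \<open>The current state is a function of the past coordinates only, hence independent of the current
  one. This replaces integrals over paths by iterated integrals over discrete laws.\<close>
lemma nn_integral_recursive_chain:
  fixes L :: "nat \<Rightarrow> 'a::countable pmf" and S :: "(nat \<Rightarrow> 'a) \<Rightarrow> nat \<Rightarrow> 's"
  assumes "\<And>\<omega>. S \<omega> 0 = s" "\<And>\<omega> t. S \<omega> (Suc t) = F t (S \<omega> t) (\<omega> t)"
  shows "(\<lambda>\<omega>. f (S \<omega> n) (\<omega> n) :: real) \<in> borel_measurable (\<Pi>\<^sub>M i\<in>UNIV. measure_pmf (L i))"
    and "(\<integral>\<^sup>+\<omega>. ennreal (f (S \<omega> n) (\<omega> n)) \<partial>(\<Pi>\<^sub>M i\<in>UNIV. measure_pmf (L i))) =
      (\<integral>\<^sup>+z. (\<integral>\<^sup>+x. ennreal (f z x) \<partial>L n) \<partial>chain_law L F s n)"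
proof -
  let ?M = "\<Pi>\<^sub>M i\<in>UNIV. measure_pmf (L i)"
  have "\<exists>G. (\<forall>\<omega>. S \<omega> n = G (map \<omega> [0..<n])) \<and> chain_law L F s n = map_pmf G (history_law L n)"
  proof (induction n)
    case 0
    show ?case by (rule exI [of _ "\<lambda>_. s"]) (simp add: assms)
  next
    case (Suc n)
    then obtain G where G: "\<And>\<omega>. S \<omega> n = G (map \<omega> [0..<n])"
      "chain_law L F s n = map_pmf G (history_law L n)" by auto
    show ?case
      by (rule exI [of _ "\<lambda>xs. F n (G (butlast xs)) (last xs)"])
        (simp add: assms G pair_pmf_def map_pmf_def bind_assoc_pmf bind_return_pmf)
  qed
  then obtain G where G: "\<And>\<omega>. S \<omega> n = G (map \<omega> [0..<n])"
    "chain_law L F s n = map_pmf G (history_law L n)" by auto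
  define h where "h xs = f (G (butlast xs)) (last xs)" for xs
  have h: "f (S \<omega> n) (\<omega> n) = h (map \<omega> [0..<Suc n])" for \<omega>
    by (simp add: h_def G)
  show "(\<lambda>\<omega>. f (S \<omega> n) (\<omega> n)) \<in> borel_measurable ?M"
    unfolding h by (rule measurable_compose [OF measurable_history]) simp
  have "(\<integral>\<^sup>+\<omega>. ennreal (f (S \<omega> n) (\<omega> n)) \<partial>?M) =
      (\<integral>\<^sup>+xs. ennreal (h xs) \<partial>distr ?M (count_space UNIV) (\<lambda>\<omega>. map \<omega> [0..<Suc n]))"
    unfolding h by (rule nn_integral_distr [symmetric, OF measurable_history]) simp
  also have "\<dots> = (\<integral>\<^sup>+xs. ennreal (h xs) \<partial>history_law L (Suc n))"
    by (simp only: distr_history)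
  also have "\<dots> = (\<integral>\<^sup>+z. (\<integral>\<^sup>+x. ennreal (f z x) \<partial>L n) \<partial>chain_law L F s n)"
    by (simp add: h_def G nn_integral_pair_pmf' case_prod_beta)
  finally show "(\<integral>\<^sup>+\<omega>. ennreal (f (S \<omega> n) (\<omega> n)) \<partial>?M) =
      (\<integral>\<^sup>+z. (\<integral>\<^sup>+x. ennreal (f z x) \<partial>L n) \<partial>chain_law L F s n)" .
qed

section \<open>Policies and demand profiles\<close>

definition express_rate :: "shipment_model \<Rightarrow> policy \<Rightarrow> nat \<Rightarrow> real" where
  "express_rate m p \<tau> = rate m * weight m (padded_fee m p \<tau>)"

text \<open>The entry \<open>C\<^bsub>n-1\<^esub>\<close> of the demand profile, so that \<open>n = 0\<close> stands for the leading zero.\<close>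
definition cumulative :: "shipment_model \<Rightarrow> policy \<Rightarrow> nat \<Rightarrow> real" where
  "cumulative m p n = (\<Sum>\<tau><n. express_rate m p \<tau>)"

lemma weight_fee_max [simp]: "weight m (fee_max m) = 0"
  by (simp add: weight_def)

lemma fee_of_weight: "fee_min m < fee_max m \<Longrightarrow> f = fee_max m - weight m f * (fee_max m - fee_min m)"
  by (simp add: weight_def)

lemma padded_fee_range:
  assumes "p \<in> policies m" "fee_min m < fee_max m"
  shows "fee_min m \<le> padded_fee m p \<tau>" "padded_fee m p \<tau> \<le> fee_max m"
proof -
  have "padded_fee m p \<tau> \<in> {fee_min m..fee_max m}"
  proof (cases "\<tau> \<le> fst p")
    case True
    then have "snd p ! \<tau> \<in> set (snd p)" using assms(1) by (auto simp: policies_def)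
    moreover have "set (snd p) \<subseteq> {fee_min m..fee_max m}" using assms(1) by (auto simp: policies_def)
    ultimately show ?thesis using True unfolding padded_fee_def by (simp only: if_True) blast
  qed (use assms in \<open>auto simp: padded_fee_def\<close>)
  then show "fee_min m \<le> padded_fee m p \<tau>" "padded_fee m p \<tau> \<le> fee_max m" by auto
qed

lemma express_rate_range:
  assumes "p \<in> policies m" "fee_min m < fee_max m" "rate m > 0"
  shows "0 \<le> express_rate m p \<tau>" "express_rate m p \<tau> \<le> rate m"
  using padded_fee_range [OF assms(1,2), of \<tau>] assms
  by (auto simp: express_rate_def weight_def mult_le_cancel_left2 divide_le_eq)

lemma express_law_eq: "express_law m p t = Poi (express_rate m p (t mod horizon m))"
  by (simp add: express_law_def express_rate_def padded_fee_def Let_def mult.commute)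
    (simp add: Poi_def)

lemma regular_law_eq: "regular_law m p t = Poi (rate m - express_rate m p (t mod horizon m))"
  by (simp add: regular_law_def express_rate_def padded_fee_def Let_def algebra_simps)

lemma expected_revenue_eq:
  assumes "p \<in> policies m"
  shows "expected_revenue m p =
    (\<Sum>\<tau><horizon m. padded_fee m p \<tau> * express_rate m p \<tau>)"
proof -
  have "(\<Sum>\<tau><horizon m. padded_fee m p \<tau> * express_rate m p \<tau>) =
      (\<Sum>\<tau>\<le>fst p. padded_fee m p \<tau> * express_rate m p \<tau>)"
    using assms by (intro sum.mono_neutral_right) (auto simp: policies_def express_rate_def padded_fee_def)
  also have "\<dots> = (\<Sum>\<tau>\<le>fst p. rate m * (snd p ! \<tau> * weight m (snd p ! \<tau>)))"
    by (intro sum.cong) (auto simp: express_rate_def padded_fee_def)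
  finally show ?thesis by (simp add: expected_revenue_def sum_distrib_left)
qed

lemma profile_eq: "profile m p = map (cumulative m p) [0..<Suc (horizon m)]"
proof -
  have "rate m * (\<Sum>j\<le>min \<tau> (fst p). weight m (snd p ! j)) = cumulative m p (Suc \<tau>)" for \<tau>
  proof -
    have "cumulative m p (Suc \<tau>) = (\<Sum>j\<in>{..<Suc \<tau>}. express_rate m p j)"
      by (simp add: cumulative_def)
    also have "\<dots> = (\<Sum>j\<le>min \<tau> (fst p). express_rate m p j)"
      by (intro sum.mono_neutral_right) (auto simp: express_rate_def padded_fee_def)
    also have "\<dots> = (\<Sum>j\<le>min \<tau> (fst p). rate m * weight m (snd p ! j))"
      by (intro sum.cong) (auto simp: express_rate_def padded_fee_def)
    finally show ?thesis by (simp add: sum_distrib_left)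
  qed
  moreover have "[0..<Suc (horizon m)] = 0 # map Suc [0..<horizon m]"
    by (simp only: upt_conv_Cons zero_less_Suc map_Suc_upt)
  ultimately show ?thesis by (simp add: profile_def cumulative_def [of m p 0] o_def del: upt_Suc)
qed

lemma profile_eq_map2_iff:
  "profile m q = map2 F (profile m p) (profile m p') \<longleftrightarrow>
    (\<forall>n\<le>horizon m. cumulative m q n = F (cumulative m p n) (cumulative m p' n))"
  unfolding profile_eq by (auto simp: list_eq_iff_nth_eq less_Suc_eq_le simp del: upt_Suc)

lemma cumulative_0 [simp]: "cumulative m p 0 = 0"
  and cumulative_diff: "cumulative m p (Suc n) - cumulative m p n = express_rate m p n"
  and cumulative_Suc: "cumulative m p (Suc n) = cumulative m p n + express_rate m p n"
  by (simp_all add: cumulative_def)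

text \<open>The weight is an affine bijection between fees and \<open>[0, 1]\<close>, so any increments in \<open>[0, \<lambda>]\<close> are
  express rates of a policy with the last possible cutoff.\<close>
lemma policy_of_profile:
  assumes m: "horizon m \<ge> 1" "rate m > 0" "fee_min m < fee_max m"
    and c: "c 0 = 0" "\<And>i. i < horizon m \<Longrightarrow> c i \<le> c (Suc i)"
      "\<And>i. i < horizon m \<Longrightarrow> c (Suc i) \<le> c i + rate m"
  shows "\<exists>q\<in>policies m. \<forall>n\<le>horizon m. cumulative m q n = c n"
proof -
  let ?T = "horizon m" and ?D = "fee_max m - fee_min m"
  define f where "f \<tau> = fee_max m - (c (Suc \<tau>) - c \<tau>) / rate m * ?D" for \<tau>
  define q where "q = (?T - 1, map f [0..<?T])"
  have "f \<tau> \<in> {fee_min m..fee_max m}" if "\<tau> < ?T" for \<tau>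
  proof -
    define u where "u = (c (Suc \<tau>) - c \<tau>) / rate m"
    have "0 \<le> u" "u \<le> 1" using c(2,3) [OF that] m by (auto simp: u_def)
    then have "0 \<le> u * ?D" "u * ?D \<le> 1 * ?D"
      using m by (auto intro!: mult_nonneg_nonneg mult_right_mono)
    then show ?thesis by (auto simp: f_def u_def)
  qed
  then have "q \<in> policies m" using m by (auto simp: policies_def q_def)
  moreover have "cumulative m q n = c n" if "n \<le> ?T" for n
    using that
  proof (induction n)
    case 0
    then show ?case by (simp add: c)
  next
    case (Suc n)
    then have "padded_fee m q n = f n" by (auto simp: padded_fee_def q_def)
    then have "express_rate m q n = c (Suc n) - c n"
      using m by (simp add: express_rate_def weight_def f_def)
    then show ?case using Suc by (simp add: cumulative_Suc)
  qed
  ultimately show ?thesis by blast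
qed

lemma policy_equiv_of_cumulative:
  assumes "rate m > 0" "fee_min m < fee_max m"
    and "\<And>n. n \<le> horizon m \<Longrightarrow> cumulative m q n = cumulative m r n"
  shows "policy_equiv m r q"
  unfolding policy_equiv_def
proof (intro allI impI)
  fix \<tau> assume "\<tau> < horizon m"
  then have "express_rate m q \<tau> = express_rate m r \<tau>"
    using assms(3) [of "Suc \<tau>"] assms(3) [of \<tau>] by (simp flip: cumulative_diff)
  then have "weight m (padded_fee m q \<tau>) = weight m (padded_fee m r \<tau>)"
    using assms(1) by (simp add: express_rate_def)
  then show "padded_fee m r \<tau> = padded_fee m q \<tau>"
    using assms(2) by (simp add: weight_def)
qed

text \<open>Increments of a pointwise minimum or maximum of two sequences lie between the bounds shared by
  the increments of both sequences.\<close>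
lemma policies_min_max_closed:
  assumes m: "horizon m \<ge> 1" "rate m > 0" "fee_min m < fee_max m"
    and p: "p \<in> policies m" "p' \<in> policies m" and F: "F = min \<or> F = max"
  shows "\<exists>q\<in>policies m. profile m q = map2 F (profile m p) (profile m p') \<and>
    (\<forall>r\<in>policies m. profile m r = map2 F (profile m p) (profile m p') \<longrightarrow> policy_equiv m r q)"
proof -
  let ?c = "\<lambda>n. F (cumulative m p n) (cumulative m p' n)"
  have "\<exists>q\<in>policies m. \<forall>n\<le>horizon m. cumulative m q n = ?c n"
  proof (rule policy_of_profile [OF m])
    show "?c 0 = 0" using F by auto
    fix i
    note range = express_rate_range [OF p(1) m(3,2), of i] express_rate_range [OF p(2) m(3,2), of i]
    show "?c i \<le> ?c (Suc i)" "?c (Suc i) \<le> ?c i + rate m"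
      using F range unfolding cumulative_Suc min_def max_def by auto
  qed
  then obtain q where q: "q \<in> policies m" "\<And>n. n \<le> horizon m \<Longrightarrow> cumulative m q n = ?c n" by blast
  then show ?thesis
    using m by (intro bexI [of _ q]) (auto simp: profile_eq_map2_iff intro!: policy_equiv_of_cumulative)
qed

section \<open>Backorders of one cycle\<close>

definition state :: "shipment_model \<Rightarrow> path \<Rightarrow> nat \<Rightarrow> nat \<times> nat" where
  "state m \<omega> t = (high_backlog m \<omega> t, total_backlog m \<omega> t)"

definition state_step :: "shipment_model \<Rightarrow> nat \<Rightarrow> nat \<times> nat \<Rightarrow> nat \<times> nat \<times> nat \<Rightarrow> nat \<times> nat" where
  "state_step m t s z =
    (let total = snd s + (fst z + fst (snd z)) - snd (snd z)
     in (if t mod horizon m \<noteq> horizon m - 1 then fst s + fst z - snd (snd z) else total, total))"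

definition step_law :: "shipment_model \<Rightarrow> policy \<Rightarrow> nat \<Rightarrow> (nat \<times> nat \<times> nat) pmf" where
  "step_law m p t = pair_pmf (express_law m p t) (pair_pmf (regular_law m p t) (capacity m))"

definition state_law :: "shipment_model \<Rightarrow> policy \<Rightarrow> nat \<Rightarrow> (nat \<times> nat) pmf" where
  "state_law m p = chain_law (step_law m p) (state_step m) (init_high m, init_total m)"

text \<open>Express and regular demand of any policy add up to the full rate, which makes the total backlog
  independent of the policy.\<close>
lemma step_law_total:
  assumes "p \<in> policies m" "fee_min m < fee_max m" "rate m > 0"
  shows "map_pmf (\<lambda>z. (fst z + fst (snd z), snd (snd z))) (step_law m p t) =
    pair_pmf (Poi (rate m)) (capacity m)"
proof -
  let ?E = "express_law m p t" and ?N = "regular_law m p t" and ?K = "capacity m"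
  have "map_pmf (\<lambda>z. (fst z + fst (snd z), snd (snd z))) (step_law m p t) =
      pair_pmf (map_pmf (\<lambda>(i, j). i + j) (pair_pmf ?E ?N)) ?K"
    by (simp add: step_law_def pair_pmf_def map_pmf_def bind_assoc_pmf bind_return_pmf)
  also have "map_pmf (\<lambda>(i, j). i + j) (pair_pmf ?E ?N) = Poi (rate m)"
    unfolding express_law_eq regular_law_eq
    using express_rate_range [OF assms] by (subst Poi_add) auto
  finally show ?thesis .
qed

lemma step_law_express:
  "map_pmf (\<lambda>z. (fst z, snd (snd z))) (step_law m p t) = pair_pmf (express_law m p t) (capacity m)"
  by (simp add: step_law_def pair_pmf_def map_pmf_def bind_assoc_pmf bind_return_pmf)

lemma total_backlog_law:
  assumes "p \<in> policies m" "fee_min m < fee_max m" "rate m > 0"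
  shows "map_pmf snd (state_law m p t) = queue_law (\<lambda>_. Poi (rate m)) (capacity m) (init_total m) t"
proof (induction t)
  case 0
  show ?case by (simp add: state_law_def)
next
  case (Suc t)
  have step: "map_pmf snd (map_pmf (state_step m t s) (step_law m p t)) =
      map_pmf (\<lambda>(d, k). snd s + d - k) (pair_pmf (Poi (rate m)) (capacity m))" for s
    unfolding step_law_total [OF assms, of t, symmetric]
    by (simp add: pmf.map_comp o_def state_step_def Let_def case_prod_unfold)
  have "map_pmf snd (state_law m p (Suc t)) = bind_pmf (map_pmf snd (state_law m p t))
      (\<lambda>x. map_pmf (\<lambda>(d, k). x + d - k) (pair_pmf (Poi (rate m)) (capacity m)))"
    by (simp add: state_law_def map_bind_pmf bind_map_pmf step)
  then show ?case by (simp add: Suc.IH)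
qed

text \<open>The law of the high-urgency backlog when a cycle starts. From the second cycle on it is that of
  the total backlog, since at the end of a cycle all waiting orders become urgent.\<close>
definition cycle_start_law :: "shipment_model \<Rightarrow> nat \<Rightarrow> nat pmf" where
  "cycle_start_law m l = (if l = 0 then return_pmf (init_high m)
     else queue_law (\<lambda>_. Poi (rate m)) (capacity m) (init_total m) (l * horizon m))"

lemma high_backlog_law:
  assumes "p \<in> policies m" "fee_min m < fee_max m" "rate m > 0" and j: "j < horizon m"
  shows "map_pmf fst (state_law m p (l * horizon m + j)) =
    bind_pmf (cycle_start_law m l) (\<lambda>x. queue_law (express_law m p) (capacity m) x j)"
  using j
proof (induction j)
  case 0
  show ?case
  proof (cases l)
    case 0
    then show ?thesis by (simp add: state_law_def cycle_start_law_def bind_return_pmf)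
  next
    case (Suc l')
    define t where "t = l' * horizon m + (horizon m - 1)"
    have t: "l * horizon m = Suc t" "t mod horizon m = horizon m - 1"
      using Suc 0 by (simp_all only: t_def mod_mult_self3) simp_all
    have "map_pmf fst (map_pmf (state_step m t s) (step_law m p t)) =
        map_pmf snd (map_pmf (state_step m t s) (step_law m p t))" for s
      using t(2) by (simp add: pmf.map_comp o_def state_step_def Let_def)
    then have "map_pmf fst (state_law m p (Suc t)) = map_pmf snd (state_law m p (Suc t))"
      by (simp add: state_law_def map_bind_pmf)
    moreover have "l \<noteq> 0" using Suc by simp
    ultimately show ?thesis
      by (simp add: t(1) total_backlog_law [OF assms(1-3)] cycle_start_law_def
          bind_return_pmf' del: queue_law.simps(2) mult_Suc)
  qed
next
  case (Suc j)
  define t where "t = l * horizon m + j"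
  have t: "t mod horizon m = j" "j \<noteq> horizon m - 1" using Suc.prems by (auto simp: t_def)
  have law: "express_law m p t = express_law m p j"
    using Suc.prems by (simp add: express_law_eq t)
  have step: "map_pmf fst (map_pmf (state_step m t s) (step_law m p t)) =
      map_pmf (\<lambda>(e, k). fst s + e - k) (pair_pmf (express_law m p j) (capacity m))" for s
    unfolding law [symmetric] step_law_express [symmetric]
    using t by (simp add: pmf.map_comp o_def state_step_def Let_def case_prod_unfold)
  have "map_pmf fst (state_law m p (Suc t)) = bind_pmf (map_pmf fst (state_law m p t))
      (\<lambda>x. map_pmf (\<lambda>(e, k). x + e - k) (pair_pmf (express_law m p j) (capacity m)))"
    by (simp add: state_law_def map_bind_pmf bind_map_pmf step)
  also have "map_pmf fst (state_law m p t) =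
      bind_pmf (cycle_start_law m l) (\<lambda>x. queue_law (express_law m p) (capacity m) x j)"
    unfolding t_def using Suc by simp
  finally show ?case by (simp add: t_def bind_assoc_pmf)
qed

text \<open>A cycle ends with one more queue step, so its backorders are the high-urgency queue after
  \<open>horizon m\<close> steps without the reset.\<close>
definition cycle_backorders :: "shipment_model \<Rightarrow> policy \<Rightarrow> nat \<Rightarrow> real" where
  "cycle_backorders m p x = mean_queue (express_law m p) (capacity m) (horizon m) x"

lemma integrable_express_law:
  assumes "p \<in> policies m" "fee_min m < fee_max m" "rate m > 0"
  shows "integrable (express_law m p t) real"
  unfolding express_law_eq by (intro integrable_Poi express_rate_range [OF assms])

text \<open>The mean over paths splits into the policy-free law of the starting state and the
  policy-dependent mean within the cycle.\<close>
lemma expectation_backorders: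
  assumes p: "p \<in> policies m" "fee_min m < fee_max m" "rate m > 0" and T: "horizon m \<ge> 1"
  shows "(\<integral>\<omega>. real (backorders m \<omega> l) \<partial>path_measure m p) =
    enn2real (\<integral>\<^sup>+x. ennreal (cycle_backorders m p x) \<partial>cycle_start_law m l)"
proof -
  let ?T = "horizon m"
  define j where "j = ?T - 1"
  define t where "t = l * ?T + j"
  have T_j: "?T = Suc j" "j < ?T" using T by (auto simp: j_def)
  have law_t: "express_law m p t = express_law m p j"
    using T_j(2) by (simp only: express_law_eq t_def mod_mult_self3 mod_less)
  define f where "f s z = real (fst s + fst z - snd (snd z))" for s :: "nat \<times> nat" and z :: "nat \<times> nat \<times> nat"
  have path: "path_measure m p = (\<Pi>\<^sub>M i\<in>UNIV. measure_pmf (step_law m p i))"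
    by (simp add: path_measure_def step_law_def)
  have back_eq: "real (backorders m \<omega> l) = f (state m \<omega> t) (\<omega> t)" for \<omega>
    using T by (simp add: backorders_def f_def state_def t_def j_def Let_def)
  have rec: "state m \<omega> 0 = (init_high m, init_total m)"
    "state m \<omega> (Suc t) = state_step m t (state m \<omega> t) (\<omega> t)" for \<omega> t
    by (simp_all add: state_def state_step_def Let_def)
  note chain = nn_integral_recursive_chain [where L = "step_law m p" and S = "state m" and f = f
      and n = t and F = "state_step m", OF rec]
  have inner: "(\<integral>\<^sup>+z. ennreal (f s z) \<partial>step_law m p t) =
      (\<integral>\<^sup>+z. ennreal (real (fst s + fst z - snd z)) \<partial>pair_pmf (express_law m p j) (capacity m))" for s
    unfolding law_t [symmetric] step_law_express [symmetric] by (simp add: f_def)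
  have "(\<integral>\<^sup>+\<omega>. ennreal (real (backorders m \<omega> l)) \<partial>path_measure m p) =
      (\<integral>\<^sup>+s. (\<integral>\<^sup>+z. ennreal (f s z) \<partial>step_law m p t) \<partial>state_law m p t)"
    unfolding path back_eq state_law_def by (rule chain(2))
  also have "\<dots> = (\<integral>\<^sup>+h. (\<integral>\<^sup>+z. ennreal (real (h + fst z - snd z))
      \<partial>pair_pmf (express_law m p j) (capacity m)) \<partial>map_pmf fst (state_law m p t))"
    by (simp add: inner)
  also have "\<dots> = (\<integral>\<^sup>+x. (\<integral>\<^sup>+y. ennreal (real y) \<partial>queue_law (express_law m p) (capacity m) x ?T)
      \<partial>cycle_start_law m l)"
    unfolding t_def high_backlog_law [OF p T_j(2)] unfolding T_j(1)
    by (simp add: nn_integral_bind_pmf case_prod_unfold)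
  also have "\<dots> = (\<integral>\<^sup>+x. ennreal (cycle_backorders m p x) \<partial>cycle_start_law m l)"
    unfolding cycle_backorders_def
    by (simp add: nn_integral_queue_law integrable_express_law [OF p])
  finally have "(\<integral>\<^sup>+\<omega>. ennreal (real (backorders m \<omega> l)) \<partial>path_measure m p) =
    (\<integral>\<^sup>+x. ennreal (cycle_backorders m p x) \<partial>cycle_start_law m l)" .
  moreover have "(\<lambda>\<omega>. real (backorders m \<omega> l)) \<in> borel_measurable (path_measure m p)"
    unfolding path back_eq by (rule chain(1))
  ultimately show ?thesis by (simp add: integral_eq_nn_integral)
qed

lemma cycle_backorders_nonneg: "0 \<le> cycle_backorders m p x"
  by (simp add: cycle_backorders_def mean_queue_def)

lemma cycle_backorders_submodular:
  assumes m: "rate m > 0" "fee_min m < fee_max m"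
    and p: "p \<in> policies m" "p' \<in> policies m"
    and pmin: "profile m pmin = map2 min (profile m p) (profile m p')"
    and pmax: "profile m pmax = map2 max (profile m p) (profile m p')"
  shows "cycle_backorders m pmin x + cycle_backorders m pmax x
    \<le> cycle_backorders m p x + cycle_backorders m p' x"
proof -
  have eq: "cycle_backorders m q x = mean_queue
      (\<lambda>i. Poi (cumulative m q (Suc i) - cumulative m q i)) (capacity m) (horizon m) x" for q
    unfolding cycle_backorders_def
    by (rule mean_queue_cong) (simp add: express_law_eq cumulative_diff)
  have incr: "cumulative m q i \<le> cumulative m q (Suc i)" if "q \<in> policies m" for q i
    using express_rate_range [OF that m(2,1), of i] by (simp add: cumulative_Suc)
  show ?thesis
    unfolding eq
    by (rule mean_queue_submodular)
      (use pmin pmax incr p in \<open>simp_all add: profile_eq_map2_iff\<close>)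
qed

section \<open>Revenue\<close>

text \<open>In terms of the express rate \<open>e\<close> at one age the revenue is \<open>U\<^bsub>max\<^esub> e - \<gamma> e\<^sup>2\<close>. Passing to minimum and
  maximum keeps the sum of the two rates and can only bring them closer together: if the profiles
  cross at this age, then the rates are exchanged for less spread ones.\<close>
lemma expected_revenue_supermodular:
  assumes m: "rate m > 0" "fee_min m < fee_max m"
    and p: "p \<in> policies m" "p' \<in> policies m" "pmin \<in> policies m" "pmax \<in> policies m"
    and pmin: "profile m pmin = map2 min (profile m p) (profile m p')"
    and pmax: "profile m pmax = map2 max (profile m p) (profile m p')"
  shows "expected_revenue m p + expected_revenue m p'
    \<le> expected_revenue m pmin + expected_revenue m pmax"
proof -
  let ?e = "express_rate m" and ?c = "cumulative m"
  define \<gamma> where "\<gamma> = (fee_max m - fee_min m) / rate m"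
  define \<phi> where "\<phi> d = fee_max m * d - \<gamma> * d ^ 2" for d
  have \<gamma>: "\<gamma> \<ge> 0" using m by (simp add: \<gamma>_def)
  have fee: "padded_fee m q \<tau> * ?e q \<tau> = \<phi> (?e q \<tau>)" for q \<tau>
  proof -
    let ?w = "weight m (padded_fee m q \<tau>)"
    have "\<gamma> * ?e q \<tau> = ?w * (fee_max m - fee_min m)"
      using m by (simp add: \<gamma>_def express_rate_def)
    then have "padded_fee m q \<tau> = fee_max m - \<gamma> * ?e q \<tau>"
      using fee_of_weight [OF m(2), of "padded_fee m q \<tau>"] by simp
    then show ?thesis
      by (simp only: \<phi>_def) (simp add: power2_eq_square algebra_simps)
  qed
  have "\<phi> (?e p \<tau>) + \<phi> (?e p' \<tau>) \<le> \<phi> (?e pmin \<tau>) + \<phi> (?e pmax \<tau>)" if "\<tau> < horizon m" for \<tau>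
  proof -
    have c: "?c pmin \<tau> = min (?c p \<tau>) (?c p' \<tau>)" "?c pmin (Suc \<tau>) = min (?c p (Suc \<tau>)) (?c p' (Suc \<tau>))"
      "?c pmax \<tau> = max (?c p \<tau>) (?c p' \<tau>)" "?c pmax (Suc \<tau>) = max (?c p (Suc \<tau>)) (?c p' (Suc \<tau>))"
      using pmin pmax that by (auto simp: profile_eq_map2_iff)
    have sum: "?e pmin \<tau> + ?e pmax \<tau> = ?e p \<tau> + ?e p' \<tau>"
      by (simp add: c min_def max_def flip: cumulative_diff)
    have squares: "(?e pmin \<tau>)\<^sup>2 + (?e pmax \<tau>)\<^sup>2 \<le> (?e p \<tau>)\<^sup>2 + (?e p' \<tau>)\<^sup>2"
    proof -
      define a b a' b' where ab: "a = ?c p \<tau>" "b = ?c p (Suc \<tau>)" "a' = ?c p' \<tau>" "b' = ?c p' (Suc \<tau>)"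
      have cross: "(s - u)\<^sup>2 + (v - w)\<^sup>2 \<le> (v - u)\<^sup>2 + (s - w)\<^sup>2"
        if "u \<le> w" "s \<le> v" for u v w s :: real
      proof -
        have "(v - u)\<^sup>2 + (s - w)\<^sup>2 - ((s - u)\<^sup>2 + (v - w)\<^sup>2) = 2 * ((w - u) * (v - s))"
          by (simp add: power2_eq_square algebra_simps)
        moreover have "0 \<le> (w - u) * (v - s)" using that by (intro mult_nonneg_nonneg) auto
        ultimately show ?thesis by linarith
      qed
      have "(min b b' - min a a')\<^sup>2 + (max b b' - max a a')\<^sup>2 \<le> (b - a)\<^sup>2 + (b' - a')\<^sup>2"
        using cross [of a a' b' b] cross [of a' a b b'] by (auto simp: min_def max_def)
      then show ?thesis by (simp add: c ab flip: cumulative_diff)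
    qed
    have "\<gamma> * ((?e pmin \<tau>)\<^sup>2 + (?e pmax \<tau>)\<^sup>2) \<le> \<gamma> * ((?e p \<tau>)\<^sup>2 + (?e p' \<tau>)\<^sup>2)"
      using squares \<gamma> by (rule mult_left_mono)
    moreover have "fee_max m * ?e pmin \<tau> + fee_max m * ?e pmax \<tau> = fee_max m * ?e p \<tau> + fee_max m * ?e p' \<tau>"
      using sum by (simp flip: distrib_left)
    ultimately show ?thesis by (simp add: \<phi>_def distrib_left)
  qed
  then show ?thesis
    unfolding expected_revenue_eq [OF p(1)] expected_revenue_eq [OF p(2)]
      expected_revenue_eq [OF p(3)] expected_revenue_eq [OF p(4)] fee sum.distrib [symmetric]
    by (intro sum_mono) auto
qed

section \<open>Long-run averages\<close>

text \<open>A sequence that does not converge would make \<open>lim\<close> meaningless. Here the means of the single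
  cycles converge, being a subsequence of the means of one function of the total backlog.\<close>
lemma expected_backorders_is_limit:
  assumes m: "horizon m \<ge> 1" "rate m > 0" "fee_min m < fee_max m"
    and load: "ennreal (rate m) < (\<integral>\<^sup>+k. ennreal (real k) \<partial>capacity m)"
    and p: "p \<in> policies m"
  shows "(\<lambda>L. (\<Sum>l<L. \<integral>\<omega>. real (backorders m \<omega> l) \<partial>path_measure m p) / real L)
      \<longlonglongrightarrow> expected_backorders m p"
    and "(\<integral>\<^sup>+x. ennreal (cycle_backorders m p x) \<partial>cycle_start_law m l) < top"
proof -
  obtain b where b: "\<And>n x. (\<integral>\<^sup>+y. ennreal (cycle_backorders m p y)
        \<partial>queue_law (\<lambda>_. Poi (rate m)) (capacity m) x n) = ennreal (b x n)"
      "\<And>x n. 0 \<le> b x n" "\<And>x. convergent (b x)"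
  proof (rule mean_queue_converges [OF m(2) load, of "cycle_backorders m p"])
    show "\<bar>cycle_backorders m p (Suc x) - cycle_backorders m p x\<bar> \<le> 1" for x
      unfolding cycle_backorders_def
      by (intro mean_queue_Suc_start integrable_express_law p m)
  qed (auto simp: cycle_backorders_nonneg)
  define e where "e l = (\<integral>\<omega>. real (backorders m \<omega> l) \<partial>path_measure m p)" for l
  show "(\<integral>\<^sup>+x. ennreal (cycle_backorders m p x) \<partial>cycle_start_law m l) < top"
    by (cases l) (simp_all add: cycle_start_law_def b(1) del: queue_law.simps mult_Suc)
  have e: "e (Suc l) = b (init_total m) (Suc l * horizon m)" for l
    unfolding e_def expectation_backorders [OF p m(3,2,1)]
    by (simp add: cycle_start_law_def b del: queue_law.simps mult_Suc)
  obtain B where B: "b (init_total m) \<longlonglongrightarrow> B" using b(3) by (auto simp: convergent_def)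
  have "strict_mono (\<lambda>l. Suc l * horizon m)" using m(1) by (intro strict_monoI) auto
  from LIMSEQ_subseq_LIMSEQ [OF B this] have "(\<lambda>l. e (Suc l)) \<longlonglongrightarrow> B" by (simp add: e o_def)
  then have "e \<longlonglongrightarrow> B" by (simp only: filterlim_sequentially_Suc)
  then have lim: "(\<lambda>L. (\<Sum>l<L. e l) / real L) \<longlonglongrightarrow> B" by (rule cesaro_mean_tendsto)
  then have "expected_backorders m p = B"
    unfolding expected_backorders_def e_def [symmetric] by (rule limI)
  with lim show "(\<lambda>L. (\<Sum>l<L. \<integral>\<omega>. real (backorders m \<omega> l) \<partial>path_measure m p) / real L)
      \<longlonglongrightarrow> expected_backorders m p"
    by (simp add: e_def)
qed

lemma expected_backorders_submodular:
  assumes m: "horizon m \<ge> 1" "rate m > 0" "fee_min m < fee_max m"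
    and load: "ennreal (rate m) < (\<integral>\<^sup>+k. ennreal (real k) \<partial>capacity m)"
    and p: "p \<in> policies m" "p' \<in> policies m" "pmin \<in> policies m" "pmax \<in> policies m"
    and pmin: "profile m pmin = map2 min (profile m p) (profile m p')"
    and pmax: "profile m pmax = map2 max (profile m p) (profile m p')"
  shows "expected_backorders m pmin + expected_backorders m pmax
    \<le> expected_backorders m p + expected_backorders m p'"
proof -
  define e where "e q l = (\<integral>\<omega>. real (backorders m \<omega> l) \<partial>path_measure m q)" for q l
  let ?I = "\<lambda>q l. \<integral>\<^sup>+x. ennreal (cycle_backorders m q x) \<partial>cycle_start_law m l"
  note lim = expected_backorders_is_limit(1) [OF m load, folded e_def]
  have e: "ennreal (e q l) = ?I q l" "0 \<le> e q l" if "q \<in> policies m" for q l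
    using expected_backorders_is_limit(2) [OF m load that, of l]
    unfolding e_def expectation_backorders [OF that m(3,2,1)] by auto
  have le: "e pmin l + e pmax l \<le> e p l + e p' l" for l
  proof -
    have sum: "ennreal (e q l + e r l) =
        (\<integral>\<^sup>+x. ennreal (cycle_backorders m q x + cycle_backorders m r x) \<partial>cycle_start_law m l)"
      if "q \<in> policies m" "r \<in> policies m" for q r
      using e that by (simp add: cycle_backorders_nonneg nn_integral_add)
    have "ennreal (e pmin l + e pmax l) \<le> ennreal (e p l + e p' l)"
      unfolding sum [OF p(3,4)] sum [OF p(1,2)]
      by (intro nn_integral_mono ennreal_leI
          cycle_backorders_submodular [OF m(2,3) p(1,2) pmin pmax])
    then show ?thesis using e(2) p by (subst (asm) ennreal_le_iff) auto
  qed
  show ?thesis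
  proof (rule LIMSEQ_le)
    show "(\<lambda>L. (\<Sum>l<L. e pmin l) / real L + (\<Sum>l<L. e pmax l) / real L)
        \<longlonglongrightarrow> expected_backorders m pmin + expected_backorders m pmax"
      by (intro tendsto_add lim p)
    show "(\<lambda>L. (\<Sum>l<L. e p l) / real L + (\<Sum>l<L. e p' l) / real L)
        \<longlonglongrightarrow> expected_backorders m p + expected_backorders m p'"
      by (intro tendsto_add lim p)
    show "\<exists>N. \<forall>L\<ge>N. (\<Sum>l<L. e pmin l) / real L + (\<Sum>l<L. e pmax l) / real L
        \<le> (\<Sum>l<L. e p l) / real L + (\<Sum>l<L. e p' l) / real L"
      unfolding add_divide_distrib [symmetric] sum.distrib [symmetric]
      using le by (auto intro!: divide_right_mono sum_mono)
  qed
qed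

theorem proposition1:
  fixes m :: shipment_model and p p' :: policy
  assumes "horizon m \<ge> 1"
    and "rate m > 0"
    and "penalty m > 0"
    and "0 \<le> fee_min m" and "fee_min m < fee_max m"
    and "set_pmf (capacity m) = UNIV"
    and "ennreal (rate m) / (\<integral>\<^sup>+k. ennreal (real k) \<partial>measure_pmf (capacity m)) < 1"
    and "init_high m \<le> init_total m"
    and "p \<in> policies m" and "p' \<in> policies m"
  shows
    "(\<exists>q\<in>policies m. profile m q = map2 min (profile m p) (profile m p') \<and>
        (\<forall>r\<in>policies m. profile m r = map2 min (profile m p) (profile m p') \<longrightarrow> policy_equiv m r q)) \<and>
     (\<exists>q\<in>policies m. profile m q = map2 max (profile m p) (profile m p') \<and>
        (\<forall>r\<in>policies m. profile m r = map2 max (profile m p) (profile m p') \<longrightarrow> policy_equiv m r q)) \<and>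
     (\<forall>pmin\<in>policies m. \<forall>pmax\<in>policies m.
        profile m pmin = map2 min (profile m p) (profile m p') \<and>
        profile m pmax = map2 max (profile m p) (profile m p') \<longrightarrow>
          expected_backorders m pmin + expected_backorders m pmax
            \<le> expected_backorders m p + expected_backorders m p' \<and>
          expected_profit m pmin + expected_profit m pmax
            \<ge> expected_profit m p + expected_profit m p')"
proof -
  note m = assms(1,2,5) and p = assms(9,10)
  have load: "ennreal (rate m) < (\<integral>\<^sup>+k. ennreal (real k) \<partial>capacity m)"
  proof (cases "\<integral>\<^sup>+k. ennreal (real k) \<partial>capacity m")
    case (real k)
    show ?thesis
    proof (cases "k = 0")
      case True
      then have "ennreal (rate m) / (\<integral>\<^sup>+k. ennreal (real k) \<partial>capacity m) = top"
        using real assms(2) by (simp add: ennreal_divide_zero)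
      then show ?thesis using assms(7) by simp
    next
      case False
      with real have "ennreal (rate m / k) < 1"
        using assms(2,7) by (simp add: divide_ennreal)
      then show ?thesis
        using False real assms(2) by (simp add: ennreal_less_iff divide_less_eq flip: ennreal_1)
    qed
  qed simp
  have "expected_backorders m pmin + expected_backorders m pmax
      \<le> expected_backorders m p + expected_backorders m p' \<and>
    expected_profit m pmin + expected_profit m pmax
      \<ge> expected_profit m p + expected_profit m p'"
    if "pmin \<in> policies m" "pmax \<in> policies m"
      "profile m pmin = map2 min (profile m p) (profile m p')"
      "profile m pmax = map2 max (profile m p) (profile m p')" for pmin pmax
  proof -
    have B: "expected_backorders m pmin + expected_backorders m pmax
        \<le> expected_backorders m p + expected_backorders m p'"
      by (rule expected_backorders_submodular [OF m load p that])
    moreover have "expected_revenue m p + expected_revenue m p'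
        \<le> expected_revenue m pmin + expected_revenue m pmax"
      by (rule expected_revenue_supermodular [OF m(2,3) p that])
    moreover have "penalty m * (expected_backorders m pmin + expected_backorders m pmax)
        \<le> penalty m * (expected_backorders m p + expected_backorders m p')"
      using B assms(3) by (intro mult_left_mono) auto
    ultimately show ?thesis by (simp add: expected_profit_def distrib_left)
  qed
  then show ?thesis
    using policies_min_max_closed [OF m p] by blast
qed

end
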